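(* Let $\mathsf{C}$ be a strict braided monoidal category. The category $\mathsf{wt}\text{-}\mathsf{Post}\text{-}\mathsf{Hopf}^{\star}$ (weak twisted post-Hopf algebras $(H,m_H,\Phi_H)$ in $\mathsf{C}$ satisfying $(m_{H}\otimes H)\circ(H\otimes c_{H,H})\circ((c_{H,H}\circ\delta_{H})\otimes H)=(m_{H}\otimes H)\circ(H\otimes c_{H,H})\circ(\delta_{H}\otimes H)$) and the category $\mathsf{HTr}^{\star}$ (Hopf trusses $(H_1,H_2,\sigma_H)$ in $\mathsf{C}$ satisfying $(\Gamma_{H_{1}}^{\sigma_{H}}\otimes H)\circ(H\otimes c_{H,H})\circ((c_{H,H}\circ\delta_{H})\otimes H)=(\Gamma_{H_{1}}^{\sigma_{H}}\otimes H)\circ(H\otimes c_{H,H})\circ(\delta_{H}\otimes H)$) are isomorphic.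
   Context: $\mathsf{C}=(\mathsf{C},\otimes,K,c)$ is a strict braided monoidal category with unit object $K$ and braiding $c_{M,N}\colon M\otimes N\to N\otimes M$. For an object $X$ and a morphism $f$, $X\otimes f$ and $f\otimes X$ denote $\mathrm{id}_X\otimes f$ and $f\otimes \mathrm{id}_X$. A Hopf algebra in $\mathsf{C}$ is $H=(H,\eta_H,\mu_H,\varepsilon_H,\delta_H,\lambda_H)$ (unit, product, counit, coproduct, antipode). A Hopf algebra morphism is an algebra and coalgebra morphism. The tensor product $D\otimes E$ of coalgebras has coproduct $(D\otimes c_{D,E}\otimes E)\circ(\delta_D\otimes\delta_E)$ and counit $\varepsilon_D\otimes\varepsilon_E$. A non-unital bialgebra $(X,\mu_X,\varepsilon_X,\delta_X)$ is a coalgebra $(X,\varepsilon_X,\delta_X)$ with an associative product $\mu_X$ that is a coalgebra morphism (no unit required); a morphism of non-unital bialgebras is a coalgebra morphism preserving products. Weak twisted post-Hopf algebra: a triple $(H,m_H,\Phi_H)$ with $H$ a Hopf algebra in $\mathsf{C}$ and morphisms $m_H\colon H\otimes H\to H$, $\Phi_H\colon H\to H$ such that: (i) $m_H$ is a coalgebra morphism; (ii) $\Phi_H$ is a coalgebra morphism; (iii) $\Phi_{H}\circ\mu_{H}\circ(\Phi_{H}\otimes m_{H})\circ(\delta_{H}\otimes H)=\mu_{H}\circ(\Phi_{H}\otimes m_{H})\circ(\delta_{H}\otimes \Phi_{H})$; (iv) $m_{H}\circ(H\otimes m_{H})=m_{H}\circ((\mu_{H}\circ(\Phi_{H}\otimes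 m_{H})\circ(\delta_{H}\otimes H))\otimes H)$; (v) $m_{H}\circ(H\otimes\mu_{H})=\mu_{H}\circ(m_{H}\otimes m_{H})\circ(H\otimes c_{H,H}\otimes H)\circ(\delta_{H}\otimes H\otimes H)$. A morphism $(H,m_H,\Phi_H)\to(B,m_B,\Phi_B)$ is a Hopf algebra morphism $f\colon H\to B$ with $f\circ m_H=m_B\circ(f\otimes f)$ and $\Phi_B\circ f=f\circ\Phi_H$. Hopf truss: $\mathbb{H}=(H_1,H_2,\sigma_H)$ where $(H,\varepsilon_H,\delta_H)$ is a coalgebra, $H_1=(H,\eta_H,\mu_H^1,\varepsilon_H,\delta_H,\lambda_H)$ is a Hopf algebra, $H_2=(H,\mu_H^2,\varepsilon_H,\delta_H)$ is a non-unital bialgebra, and $\sigma_H\colon H\to H$ is a coalgebra morphism such that $\mu_{H}^{2}\circ(H\otimes\mu_{H}^{1})=\mu_{H}^{1}\circ(\mu_{H}^{2}\otimes\Gamma_{H_{1}}^{\sigma_{H}})\circ(H\otimes c_{H,H}\otimes H)\circ(\delta_{H}\otimes H\otimes H)$, where $\Gamma_{H_{1}}^{\sigma_{H}}:=\mu_{H}^{1}\circ((\lambda_{H}\circ\sigma_{H})\otimes\mu_{H}^{2})\circ(\delta_{H}\otimes H)$. A morphism of Hopf trusses $(H_1,H_2,\sigma_H)\to(B_1,B_2,\sigma_B)$ is a morphism $f$ that is a Hopf algebra morphism $H_1\to B_1$ and a morphism of non-unital bialgebras $H_2\to B_2$. $\mathsf{wt}\text{-}\mathsf{Post}\text{-}\mathsf{Hopf}^{\star}$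 and $\mathsf{HTr}^{\star}$ are the full subcategories of the categories of weak twisted post-Hopf algebras and of Hopf trusses on the objects satisfying the respective displayed conditions. *)

theory Defs
  imports Main
begin

record ('o, 'a) category =
  Obj :: "'o set"
  Arr :: "'a set"
  Dom :: "'a \<Rightarrow> 'o"
  Cod :: "'a \<Rightarrow> 'o"
  Ident :: "'o \<Rightarrow> 'a" (\<open>\<I>\<index>\<close>)
  Comp :: "'a \<Rightarrow> 'a \<Rightarrow> 'a" (infixl \<open>\<cdot>\<index>\<close> 70)

definition Hom :: "('o, 'a, 'z) category_scheme \<Rightarrow> 'o \<Rightarrow> 'o \<Rightarrow> 'a set" (\<open>Hom\<index>\<close>) where
  "Hom\<^bsub>C\<^esub> X Y = {f \<in> Arr C. Dom C f = X \<and> Cod C f = Y}"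

text \<open>Composition is only constrained on composable pairs; \<open>g \<cdot> f\<close> is \<open>g\<close> after \<open>f\<close>.\<close>

locale category =
  fixes C :: "('o, 'a, 'z) category_scheme" (structure)
  assumes Dom_in_Obj: "f \<in> Arr C \<Longrightarrow> Dom C f \<in> Obj C"
    and Cod_in_Obj: "f \<in> Arr C \<Longrightarrow> Cod C f \<in> Obj C"
    and Ident_in_Hom: "X \<in> Obj C \<Longrightarrow> \<I> X \<in> Hom X X"
    and Comp_in_Hom: "\<lbrakk>f \<in> Hom X Y; g \<in> Hom Y Z\<rbrakk> \<Longrightarrow> g \<cdot> f \<in> Hom X Z"
    and Comp_Ident_left: "f \<in> Hom X Y \<Longrightarrow> \<I> Y \<cdot> f = f"
    and Comp_Ident_right: "f \<in> Hom X Y \<Longrightarrow> f \<cdot> \<I> X = f"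
    and Comp_assoc: "\<lbrakk>f \<in> Hom X Y; g \<in> Hom Y Z; h \<in> Hom Z W\<rbrakk> \<Longrightarrow> h \<cdot> (g \<cdot> f) = (h \<cdot> g) \<cdot> f"

locale covariant_functor =
  source: category C + target: category D
  for C :: "('o, 'a, 'y) category_scheme" and D :: "('p, 'b, 'z) category_scheme" +
  fixes Fo :: "'o \<Rightarrow> 'p" and Fa :: "'a \<Rightarrow> 'b"
  assumes maps_Obj: "X \<in> Obj C \<Longrightarrow> Fo X \<in> Obj D"
    and maps_Hom: "f \<in> Hom\<^bsub>C\<^esub> X Y \<Longrightarrow> Fa f \<in> Hom\<^bsub>D\<^esub> (Fo X) (Fo Y)"
    and maps_Ident: "X \<in> Obj C \<Longrightarrow> Fa (\<I>\<^bsub>C\<^esub> X) = \<I>\<^bsub>D\<^esub> (Fo X)"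
    and maps_Comp: "\<lbrakk>f \<in> Hom\<^bsub>C\<^esub> X Y; g \<in> Hom\<^bsub>C\<^esub> Y Z\<rbrakk> \<Longrightarrow> Fa (g \<cdot>\<^bsub>C\<^esub> f) = Fa g \<cdot>\<^bsub>D\<^esub> Fa f"

text \<open>Isomorphism (not mere equivalence) of categories: the two composites are equal to the identity
  functors on objects and on arrows.\<close>

definition isomorphic_categories ::
    "('o, 'a, 'y) category_scheme \<Rightarrow> ('p, 'b, 'z) category_scheme \<Rightarrow> bool" where
  "isomorphic_categories C D \<longleftrightarrow>
    (\<exists>Fo Fa Go Ga. covariant_functor C D Fo Fa \<and> covariant_functor D C Go Ga \<and>
      (\<forall>X \<in> Obj C. Go (Fo X) = X) \<and> (\<forall>f \<in> Arr C. Ga (Fa f) = f) \<and>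
      (\<forall>Y \<in> Obj D. Fo (Go Y) = Y) \<and> (\<forall>g \<in> Arr D. Fa (Ga g) = g))"

definition full_subcategory :: "('o, 'a) category \<Rightarrow> ('o \<Rightarrow> bool) \<Rightarrow> ('o, 'a) category" where
  "full_subcategory C P =
    C\<lparr>Obj := {X \<in> Obj C. P X}, Arr := {f \<in> Arr C. P (Dom C f) \<and> P (Cod C f)}\<rparr>"

record ('o, 'a) monoidal_category = "('o, 'a) category" +
  Tensor_Obj :: "'o \<Rightarrow> 'o \<Rightarrow> 'o" (infixr \<open>\<otimes>\<^sub>o\<index>\<close> 75)
  Tensor :: "'a \<Rightarrow> 'a \<Rightarrow> 'a" (infixr \<open>\<otimes>\<index>\<close> 75)
  Unit_Obj :: 'o (\<open>\<K>\<index>\<close>)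

locale strict_monoidal_category = category C
  for C :: "('o, 'a, 'z) monoidal_category_scheme" (structure) +
  assumes Tensor_Obj_in_Obj: "\<lbrakk>X \<in> Obj C; Y \<in> Obj C\<rbrakk> \<Longrightarrow> X \<otimes>\<^sub>o Y \<in> Obj C"
    and Unit_Obj_in_Obj: "\<K> \<in> Obj C"
    and Tensor_in_Hom: "\<lbrakk>f \<in> Hom X X'; g \<in> Hom Y Y'\<rbrakk> \<Longrightarrow> f \<otimes> g \<in> Hom (X \<otimes>\<^sub>o Y) (X' \<otimes>\<^sub>o Y')"
    and Tensor_Ident: "\<lbrakk>X \<in> Obj C; Y \<in> Obj C\<rbrakk> \<Longrightarrow> \<I> X \<otimes> \<I> Y = \<I> (X \<otimes>\<^sub>o Y)"
    and Tensor_Comp: "\<lbrakk>f \<in> Hom X X'; f' \<in> Hom X' X''; g \<in> Hom Y Y'; g' \<in> Hom Y' Y''\<rbrakk>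
      \<Longrightarrow> (f' \<cdot> f) \<otimes> (g' \<cdot> g) = (f' \<otimes> g') \<cdot> (f \<otimes> g)"
    and Tensor_Obj_assoc: "\<lbrakk>X \<in> Obj C; Y \<in> Obj C; Z \<in> Obj C\<rbrakk>
      \<Longrightarrow> (X \<otimes>\<^sub>o Y) \<otimes>\<^sub>o Z = X \<otimes>\<^sub>o (Y \<otimes>\<^sub>o Z)"
    and Tensor_assoc: "\<lbrakk>f \<in> Arr C; g \<in> Arr C; h \<in> Arr C\<rbrakk> \<Longrightarrow> (f \<otimes> g) \<otimes> h = f \<otimes> (g \<otimes> h)"
    and Unit_Obj_left: "X \<in> Obj C \<Longrightarrow> \<K> \<otimes>\<^sub>o X = X"
    and Unit_Obj_right: "X \<in> Obj C \<Longrightarrow> X \<otimes>\<^sub>o \<K> = X"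
    and Unit_left: "f \<in> Arr C \<Longrightarrow> \<I> \<K> \<otimes> f = f"
    and Unit_right: "f \<in> Arr C \<Longrightarrow> f \<otimes> \<I> \<K> = f"

record ('o, 'a) braided_category = "('o, 'a) monoidal_category" +
  Braiding :: "'o \<Rightarrow> 'o \<Rightarrow> 'a" (\<open>\<c>\<index>\<close>)

locale strict_braided_monoidal_category = strict_monoidal_category C
  for C :: "('o, 'a, 'z) braided_category_scheme" (structure) +
  assumes Braiding_in_Hom: "\<lbrakk>X \<in> Obj C; Y \<in> Obj C\<rbrakk> \<Longrightarrow> \<c> X Y \<in> Hom (X \<otimes>\<^sub>o Y) (Y \<otimes>\<^sub>o X)"
    and Braiding_iso: "\<lbrakk>X \<in> Obj C; Y \<in> Obj C\<rbrakk> \<Longrightarrow> \<exists>d \<in> Hom (Y \<otimes>\<^sub>o X) (X \<otimes>\<^sub>o Y).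
      d \<cdot> \<c> X Y = \<I> (X \<otimes>\<^sub>o Y) \<and> \<c> X Y \<cdot> d = \<I> (Y \<otimes>\<^sub>o X)"
    and Braiding_natural: "\<lbrakk>f \<in> Hom X X'; g \<in> Hom Y Y'\<rbrakk>
      \<Longrightarrow> \<c> X' Y' \<cdot> (f \<otimes> g) = (g \<otimes> f) \<cdot> \<c> X Y"
    and hexagon_right: "\<lbrakk>X \<in> Obj C; Y \<in> Obj C; Z \<in> Obj C\<rbrakk>
      \<Longrightarrow> \<c> X (Y \<otimes>\<^sub>o Z) = (\<I> Y \<otimes> \<c> X Z) \<cdot> (\<c> X Y \<otimes> \<I> Z)"
    and hexagon_left: "\<lbrakk>X \<in> Obj C; Y \<in> Obj C; Z \<in> Obj C\<rbrakk>
      \<Longrightarrow> \<c> (X \<otimes>\<^sub>o Y) Z = (\<c> X Z \<otimes> \<I> Y) \<cdot> (\<I> X \<otimes> \<c> Y Z)"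

record ('o, 'a) coalgebra =
  carr :: 'o
  counit :: 'a (\<open>\<epsilon>\<index>\<close>)
  coprod :: 'a (\<open>\<delta>\<index>\<close>)

record ('o, 'a) nonunital_bialgebra = "('o, 'a) coalgebra" +
  mult :: 'a (\<open>\<mu>\<index>\<close>)

record ('o, 'a) hopf_algebra = "('o, 'a) nonunital_bialgebra" +
  unity :: 'a (\<open>\<eta>\<index>\<close>)
  antipode :: 'a

type_synonym ('o, 'a) wt_post_hopf = "('o, 'a) hopf_algebra \<times> 'a \<times> 'a"
type_synonym ('o, 'a) hopf_truss =
  "('o, 'a) hopf_algebra \<times> ('o, 'a) nonunital_bialgebra \<times> 'a"

context
  fixes C :: "('o, 'a, 'z) braided_category_scheme" (structure)
begin

definition is_coalgebra :: "('o, 'a, 'y) coalgebra_scheme \<Rightarrow> bool" where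
  "is_coalgebra D \<longleftrightarrow>
    carr D \<in> Obj C \<and>
    \<epsilon>\<^bsub>D\<^esub> \<in> Hom (carr D) \<K> \<and>
    \<delta>\<^bsub>D\<^esub> \<in> Hom (carr D) (carr D \<otimes>\<^sub>o carr D) \<and>
    (\<epsilon>\<^bsub>D\<^esub> \<otimes> \<I> (carr D)) \<cdot> \<delta>\<^bsub>D\<^esub> = \<I> (carr D) \<and>
    (\<I> (carr D) \<otimes> \<epsilon>\<^bsub>D\<^esub>) \<cdot> \<delta>\<^bsub>D\<^esub> = \<I> (carr D) \<and>
    (\<delta>\<^bsub>D\<^esub> \<otimes> \<I> (carr D)) \<cdot> \<delta>\<^bsub>D\<^esub> = (\<I> (carr D) \<otimes> \<delta>\<^bsub>D\<^esub>) \<cdot> \<delta>\<^bsub>D\<^esub>"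

definition coalgebra_mor ::
    "('o, 'a, 'x) coalgebra_scheme \<Rightarrow> ('o, 'a, 'y) coalgebra_scheme \<Rightarrow> 'a \<Rightarrow> bool" where
  "coalgebra_mor D E f \<longleftrightarrow>
    f \<in> Hom (carr D) (carr E) \<and>
    \<epsilon>\<^bsub>E\<^esub> \<cdot> f = \<epsilon>\<^bsub>D\<^esub> \<and>
    \<delta>\<^bsub>E\<^esub> \<cdot> f = (f \<otimes> f) \<cdot> \<delta>\<^bsub>D\<^esub>"

definition tensor_coalgebra ::
    "('o, 'a, 'x) coalgebra_scheme \<Rightarrow> ('o, 'a, 'y) coalgebra_scheme \<Rightarrow> ('o, 'a) coalgebra" where
  "tensor_coalgebra D E =
    \<lparr>carr = carr D \<otimes>\<^sub>o carr E,
     counit = \<epsilon>\<^bsub>D\<^esub> \<otimes> \<epsilon>\<^bsub>E\<^esub>,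
     coprod = (\<I> (carr D) \<otimes> \<c> (carr D) (carr E) \<otimes> \<I> (carr E)) \<cdot> (\<delta>\<^bsub>D\<^esub> \<otimes> \<delta>\<^bsub>E\<^esub>)\<rparr>"

text \<open>By strictness the coproduct of the unit object is an arrow \<open>\<K> \<rightarrow> \<K> = \<K> \<otimes> \<K>\<close>.\<close>

definition unit_coalgebra :: "('o, 'a) coalgebra" where
  "unit_coalgebra = \<lparr>carr = \<K>, counit = \<I> \<K>, coprod = \<I> \<K>\<rparr>"

definition is_nonunital_bialgebra :: "('o, 'a, 'y) nonunital_bialgebra_scheme \<Rightarrow> bool" where
  "is_nonunital_bialgebra X \<longleftrightarrow>
    is_coalgebra X \<and>
    coalgebra_mor (tensor_coalgebra X X) X \<mu>\<^bsub>X\<^esub> \<and>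
    \<mu>\<^bsub>X\<^esub> \<cdot> (\<mu>\<^bsub>X\<^esub> \<otimes> \<I> (carr X)) = \<mu>\<^bsub>X\<^esub> \<cdot> (\<I> (carr X) \<otimes> \<mu>\<^bsub>X\<^esub>)"

definition nonunital_bialgebra_mor :: "('o, 'a, 'x) nonunital_bialgebra_scheme
    \<Rightarrow> ('o, 'a, 'y) nonunital_bialgebra_scheme \<Rightarrow> 'a \<Rightarrow> bool" where
  "nonunital_bialgebra_mor X Y f \<longleftrightarrow>
    coalgebra_mor X Y f \<and> f \<cdot> \<mu>\<^bsub>X\<^esub> = \<mu>\<^bsub>Y\<^esub> \<cdot> (f \<otimes> f)"

text \<open>A bialgebra is expressed by saying that product and unit are coalgebra morphisms, which is the
  same system of equations as saying that coproduct and counit are algebra morphisms.\<close>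

definition is_hopf_algebra :: "('o, 'a) hopf_algebra \<Rightarrow> bool" where
  "is_hopf_algebra H \<longleftrightarrow>
    is_nonunital_bialgebra H \<and>
    coalgebra_mor unit_coalgebra H \<eta>\<^bsub>H\<^esub> \<and>
    \<mu>\<^bsub>H\<^esub> \<cdot> (\<eta>\<^bsub>H\<^esub> \<otimes> \<I> (carr H)) = \<I> (carr H) \<and>
    \<mu>\<^bsub>H\<^esub> \<cdot> (\<I> (carr H) \<otimes> \<eta>\<^bsub>H\<^esub>) = \<I> (carr H) \<and>
    antipode H \<in> Hom (carr H) (carr H) \<and>
    \<mu>\<^bsub>H\<^esub> \<cdot> (\<I> (carr H) \<otimes> antipode H) \<cdot> \<delta>\<^bsub>H\<^esub> = \<eta>\<^bsub>H\<^esub> \<cdot> \<epsilon>\<^bsub>H\<^esub> \<and>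
    \<mu>\<^bsub>H\<^esub> \<cdot> (antipode H \<otimes> \<I> (carr H)) \<cdot> \<delta>\<^bsub>H\<^esub> = \<eta>\<^bsub>H\<^esub> \<cdot> \<epsilon>\<^bsub>H\<^esub>"

definition hopf_algebra_mor ::
    "('o, 'a) hopf_algebra \<Rightarrow> ('o, 'a) hopf_algebra \<Rightarrow> 'a \<Rightarrow> bool" where
  "hopf_algebra_mor H B f \<longleftrightarrow>
    coalgebra_mor H B f \<and>
    f \<cdot> \<eta>\<^bsub>H\<^esub> = \<eta>\<^bsub>B\<^esub> \<and>
    f \<cdot> \<mu>\<^bsub>H\<^esub> = \<mu>\<^bsub>B\<^esub> \<cdot> (f \<otimes> f)"

text \<open>The category whose objects are structures \<open>A\<close> with underlying object \<open>U A\<close> in \<open>C\<close>. Its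
  arrows carry their source and target structures, because one arrow of \<open>C\<close> may be a morphism between
  several pairs of structures.\<close>

definition structure_category ::
    "'s set \<Rightarrow> ('s \<Rightarrow> 'o) \<Rightarrow> ('s \<Rightarrow> 's \<Rightarrow> 'a \<Rightarrow> bool) \<Rightarrow> ('s, 's \<times> 'a \<times> 's) category" where
  "structure_category S U mor =
    \<lparr>Obj = S,
     Arr = {(A, f, B). A \<in> S \<and> B \<in> S \<and> mor A B f},
     Dom = (\<lambda>(A, f, B). A),
     Cod = (\<lambda>(A, f, B). B),
     Ident = (\<lambda>A. (A, \<I> (U A), A)),
     Comp = (\<lambda>(B', g, B) (A, f, A'). (A, g \<cdot> f, B))\<rparr>"

definition is_wt_post_hopf :: "('o, 'a) wt_post_hopf \<Rightarrow> bool" where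
  "is_wt_post_hopf = (\<lambda>(A, m, \<Phi>). let H = carr A in
    is_hopf_algebra A \<and>
    coalgebra_mor (tensor_coalgebra A A) A m \<and>
    coalgebra_mor A A \<Phi> \<and>
    \<Phi> \<cdot> \<mu>\<^bsub>A\<^esub> \<cdot> (\<Phi> \<otimes> m) \<cdot> (\<delta>\<^bsub>A\<^esub> \<otimes> \<I> H) = \<mu>\<^bsub>A\<^esub> \<cdot> (\<Phi> \<otimes> m) \<cdot> (\<delta>\<^bsub>A\<^esub> \<otimes> \<Phi>) \<and>
    m \<cdot> (\<I> H \<otimes> m) = m \<cdot> ((\<mu>\<^bsub>A\<^esub> \<cdot> (\<Phi> \<otimes> m) \<cdot> (\<delta>\<^bsub>A\<^esub> \<otimes> \<I> H)) \<otimes> \<I> H) \<and>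
    m \<cdot> (\<I> H \<otimes> \<mu>\<^bsub>A\<^esub>) =
      \<mu>\<^bsub>A\<^esub> \<cdot> (m \<otimes> m) \<cdot> (\<I> H \<otimes> \<c> H H \<otimes> \<I> H) \<cdot> (\<delta>\<^bsub>A\<^esub> \<otimes> \<I> H \<otimes> \<I> H))"

definition wt_post_hopf_mor :: "('o, 'a) wt_post_hopf \<Rightarrow> ('o, 'a) wt_post_hopf \<Rightarrow> 'a \<Rightarrow> bool" where
  "wt_post_hopf_mor = (\<lambda>(A, m, \<Phi>) (A', m', \<Phi>') f.
    hopf_algebra_mor A A' f \<and>
    f \<cdot> m = m' \<cdot> (f \<otimes> f) \<and>
    \<Phi>' \<cdot> f = f \<cdot> \<Phi>)"

definition wt_Post_Hopf ::
    "(('o, 'a) wt_post_hopf, ('o, 'a) wt_post_hopf \<times> 'a \<times> ('o, 'a) wt_post_hopf) category" where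
  "wt_Post_Hopf = structure_category {A. is_wt_post_hopf A} (\<lambda>(A, m, \<Phi>). carr A) wt_post_hopf_mor"

definition truss_Gamma ::
    "('o, 'a) hopf_algebra \<Rightarrow> ('o, 'a) nonunital_bialgebra \<Rightarrow> 'a \<Rightarrow> 'a" where
  "truss_Gamma A1 A2 \<sigma> =
    \<mu>\<^bsub>A1\<^esub> \<cdot> ((antipode A1 \<cdot> \<sigma>) \<otimes> \<mu>\<^bsub>A2\<^esub>) \<cdot> (\<delta>\<^bsub>A1\<^esub> \<otimes> \<I> (carr A1))"

definition is_hopf_truss :: "('o, 'a) hopf_truss \<Rightarrow> bool" where
  "is_hopf_truss = (\<lambda>(A1, A2, \<sigma>). let H = carr A1 in
    carr A2 = carr A1 \<and> counit A2 = counit A1 \<and> coprod A2 = coprod A1 \<and>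
    is_hopf_algebra A1 \<and>
    is_nonunital_bialgebra A2 \<and>
    coalgebra_mor A1 A1 \<sigma> \<and>
    \<mu>\<^bsub>A2\<^esub> \<cdot> (\<I> H \<otimes> \<mu>\<^bsub>A1\<^esub>) =
      \<mu>\<^bsub>A1\<^esub> \<cdot> (\<mu>\<^bsub>A2\<^esub> \<otimes> truss_Gamma A1 A2 \<sigma>) \<cdot> (\<I> H \<otimes> \<c> H H \<otimes> \<I> H) \<cdot> (\<delta>\<^bsub>A1\<^esub> \<otimes> \<I> H \<otimes> \<I> H))"

definition hopf_truss_mor :: "('o, 'a) hopf_truss \<Rightarrow> ('o, 'a) hopf_truss \<Rightarrow> 'a \<Rightarrow> bool" where
  "hopf_truss_mor = (\<lambda>(A1, A2, \<sigma>) (B1, B2, \<tau>) f.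
    hopf_algebra_mor A1 B1 f \<and> nonunital_bialgebra_mor A2 B2 f)"

definition HTr ::
    "(('o, 'a) hopf_truss, ('o, 'a) hopf_truss \<times> 'a \<times> ('o, 'a) hopf_truss) category" where
  "HTr = structure_category {A. is_hopf_truss A} (\<lambda>(A1, A2, \<sigma>). carr A1) hopf_truss_mor"

text \<open>The cocommutativity-type condition imposed on \<open>t = m\<close> and on \<open>t = \<Gamma>\<close>.\<close>

definition star_condition :: "('o, 'a, 'y) coalgebra_scheme \<Rightarrow> 'a \<Rightarrow> bool" where
  "star_condition A t \<longleftrightarrow> (let H = carr A in
    (t \<otimes> \<I> H) \<cdot> (\<I> H \<otimes> \<c> H H) \<cdot> ((\<c> H H \<cdot> \<delta>\<^bsub>A\<^esub>) \<otimes> \<I> H) =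
    (t \<otimes> \<I> H) \<cdot> (\<I> H \<otimes> \<c> H H) \<cdot> (\<delta>\<^bsub>A\<^esub> \<otimes> \<I> H))"

definition wt_Post_Hopf_star ::
    "(('o, 'a) wt_post_hopf, ('o, 'a) wt_post_hopf \<times> 'a \<times> ('o, 'a) wt_post_hopf) category" where
  "wt_Post_Hopf_star = full_subcategory wt_Post_Hopf (\<lambda>(A, m, \<Phi>). star_condition A m)"

definition HTr_star ::
    "(('o, 'a) hopf_truss, ('o, 'a) hopf_truss \<times> 'a \<times> ('o, 'a) hopf_truss) category" where
  "HTr_star = full_subcategory HTr (\<lambda>(A1, A2, \<sigma>). star_condition A1 (truss_Gamma A1 A2 \<sigma>))"

end

end

theory Submission
  imports Defs
begin

text \<open>
For a coalgebra \<open>D\<close> and an algebra \<open>X\<close>, the arrows from \<open>D\<close> to \<open>X\<close> form a monoid under convolution.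
Let \<open>q = \<I> H \<otimes> \<epsilon>\<close> be the projection of \<open>H \<otimes> H\<close> onto its first factor. In the convolution monoid of
arrows from \<open>H \<otimes> H\<close> to \<open>H\<close>, the second product of the truss of a post-Hopf algebra \<open>(m, \<Phi>)\<close> is
\<open>(\<Phi> \<cdot> q) * m\<close>, and the arrow \<open>\<Gamma>\<close> of a truss with second product \<open>M\<close> and cocycle \<open>\<sigma>\<close> is
\<open>(\<lambda> \<cdot> \<sigma> \<cdot> q) * M\<close>, where \<open>\<lambda>\<close> is the antipode. Since composition with the antipode inverts coalgebra
morphisms, these assignments, with \<open>\<sigma> = \<Phi>\<close>, are mutually inverse (\<open>gam_circ\<close>).

That both results are again coalgebra morphisms is where the star conditions enter. An arrow \<open>f\<close> with
\<open>\<epsilon> \<cdot> f = \<epsilon>\<close> is a coalgebra morphism precisely if \<open>\<delta> \<cdot> f = inl f * inr f\<close> for the two embeddings of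
\<open>H\<close> into the algebra \<open>H \<otimes> H\<close>, and the star condition for \<open>t\<close> makes \<open>inr (f \<cdot> q)\<close> and \<open>inl t\<close>
commute (\<open>star_condition_commute\<close>). The coproduct of the convolution can then be rearranged
(\<open>coalgebra_mor_conv\<close>, \<open>coalgebra_mor_antipode_conv\<close>).

The remaining axioms are equations in the convolution monoid of arrows from \<open>H \<otimes> H \<otimes> H\<close> to \<open>H\<close>. The
distributive laws give \<open>t \<cdot> (\<I> H \<otimes> (a * b)) = (u \<cdot> (\<I> H \<otimes> a)) * (v \<cdot> (\<I> H \<otimes> b))\<close> for arbitrary
\<open>a\<close> and \<open>b\<close> (\<open>distributes_conv\<close>), from which associativity of the second product, and conversely the
axioms of \<open>\<Gamma>\<close>, follow (\<open>truss_of_post_hopf\<close>, \<open>post_hopf_of_truss\<close>).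

On morphisms the underlying arrow is kept. A morphism of trusses commutes with the cocycles although
this is not part of its definition, because the cocycle is \<open>x \<mapsto> x \<circ> 1\<close> for the second product
\<open>\<circ>\<close> and the unit of the first (\<open>truss_cocycle\<close>).
\<close>

section \<open>Calculus in a strict braided monoidal category\<close>

lemma Hom_iff: "f \<in> Hom\<^bsub>C\<^esub> X Y \<longleftrightarrow> f \<in> Arr C \<and> Dom C f = X \<and> Cod C f = Y"
  by (simp add: Hom_def)

context strict_braided_monoidal_category
begin

lemma Ident_typing [simp]:
  assumes "X \<in> Obj C"
  shows "\<I> X \<in> Arr C" "Dom C (\<I> X) = X" "Cod C (\<I> X) = X"
  using Ident_in_Hom[OF assms] by (simp_all add: Hom_iff)

lemma Comp_typing [simp]:
  assumes "f \<in> Arr C" "g \<in> Arr C" "Dom C g = Cod C f"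
  shows "g \<cdot> f \<in> Arr C" "Dom C (g \<cdot> f) = Dom C f" "Cod C (g \<cdot> f) = Cod C g"
  using Comp_in_Hom[of f "Dom C f" "Cod C f" g "Cod C g"] assms by (simp_all add: Hom_iff)

lemma Tensor_typing [simp]:
  assumes "f \<in> Arr C" "g \<in> Arr C"
  shows "f \<otimes> g \<in> Arr C" "Dom C (f \<otimes> g) = Dom C f \<otimes>\<^sub>o Dom C g"
    "Cod C (f \<otimes> g) = Cod C f \<otimes>\<^sub>o Cod C g"
  using Tensor_in_Hom[of f "Dom C f" "Cod C f" g "Dom C g" "Cod C g"] assms
  by (simp_all add: Hom_iff)

lemma Braiding_typing [simp]:
  assumes "X \<in> Obj C" "Y \<in> Obj C"
  shows "\<c> X Y \<in> Arr C" "Dom C (\<c> X Y) = X \<otimes>\<^sub>o Y" "Cod C (\<c> X Y) = Y \<otimes>\<^sub>o X"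
  using Braiding_in_Hom[OF assms] by (simp_all add: Hom_iff)

declare Dom_in_Obj [simp] Cod_in_Obj [simp] Tensor_Obj_in_Obj [simp] Unit_Obj_in_Obj [simp]
  Tensor_Obj_assoc [simp] Unit_Obj_left [simp] Unit_Obj_right [simp]
  Unit_left [simp] Unit_right [simp]

lemma Comp_Ident [simp]:
  assumes "f \<in> Arr C"
  shows "Cod C f = Y \<Longrightarrow> \<I> Y \<cdot> f = f" "Dom C f = X \<Longrightarrow> f \<cdot> \<I> X = f"
  using assms Comp_Ident_left[of f] Comp_Ident_right[of f] by (auto simp: Hom_iff)

lemma comp_assoc:
  assumes "f \<in> Arr C" "g \<in> Arr C" "h \<in> Arr C" "Dom C g = Cod C f" "Dom C h = Cod C g"
  shows "(h \<cdot> g) \<cdot> f = h \<cdot> (g \<cdot> f)"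
  using Comp_assoc[of f "Dom C f" "Cod C f" g "Cod C g" h "Cod C h"] assms by (simp add: Hom_iff)

lemma interchange:
  assumes "f \<in> Arr C" "f' \<in> Arr C" "g \<in> Arr C" "g' \<in> Arr C"
    "Dom C f' = Cod C f" "Dom C g' = Cod C g"
  shows "(f' \<otimes> g') \<cdot> (f \<otimes> g) = (f' \<cdot> f) \<otimes> (g' \<cdot> g)"
  using Tensor_Comp[of f "Dom C f" "Cod C f" f' "Cod C f'" g "Dom C g" "Cod C g" g' "Cod C g'"] assms
  by (simp add: Hom_iff)

text \<open>The interchange law for two parallel composites whose blocks do not line up: in \<open>interchange21\<close> one
factor below faces two factors above, in \<open>interchange12\<close> it is the other way round. Tensor products
are nested to the right, so these are the groupings that the law itself does not match.\<close>

lemma interchange21: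
  assumes "a \<in> Arr C" "b \<in> Arr C" "r \<in> Arr C" "k \<in> Arr C" "s \<in> Arr C"
    "Cod C k = Dom C a \<otimes>\<^sub>o Dom C b" "Dom C r = Cod C s"
  shows "(a \<otimes> b \<otimes> r) \<cdot> (k \<otimes> s) = ((a \<otimes> b) \<cdot> k) \<otimes> (r \<cdot> s)"
  using assms by (simp add: interchange flip: Tensor_assoc)

lemma interchange12:
  assumes "a \<in> Arr C" "b \<in> Arr C" "r \<in> Arr C" "k \<in> Arr C" "s \<in> Arr C"
    "Dom C k = Cod C a \<otimes>\<^sub>o Cod C b" "Dom C s = Cod C r"
  shows "(k \<otimes> s) \<cdot> (a \<otimes> b \<otimes> r) = (k \<cdot> (a \<otimes> b)) \<otimes> (s \<cdot> r)"
  using assms by (simp add: interchange flip: Tensor_assoc)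

lemma Ident_Tensor:
  "\<lbrakk>X \<in> Obj C; Y \<in> Obj C\<rbrakk> \<Longrightarrow> \<I> (X \<otimes>\<^sub>o Y) = \<I> X \<otimes> \<I> Y"
  by (simp add: Tensor_Ident)

text \<open>Turns an equation between composites into a rewrite rule for the same composite inside a chain that
is nested to the right.\<close>

lemma comp_left:
  assumes "g \<cdot> f = h" "g \<in> Arr C" "f \<in> Arr C" "Dom C g = Cod C f" "k \<in> Arr C" "Cod C k = Dom C f"
  shows "g \<cdot> (f \<cdot> k) = h \<cdot> k"
  using assms by (metis comp_assoc)

lemmas interchange_left = comp_left[OF interchange]
  and interchange21_left = comp_left[OF interchange21]
  and interchange12_left = comp_left[OF interchange12]

text \<open>Two normal forms for arrows built from \<open>\<cdot>\<close> and \<open>\<otimes>\<close>, that is, for string diagrams: \<open>merge\<close> moves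
tensor products to the outside as far as blocks line up, and \<open>slices\<close> moves composition to the outside,
giving a chain of tensor products. Either set splits the identity of a tensor product.\<close>

lemmas merge = Ident_Tensor comp_assoc Tensor_assoc interchange interchange21 interchange12
  interchange_left interchange21_left interchange12_left

lemma comp_whisker:
  assumes "f \<in> Arr C" "g \<in> Arr C" "Dom C g = Cod C f" "h \<in> Arr C"
  shows "(g \<cdot> f) \<otimes> h = (g \<otimes> \<I> (Cod C h)) \<cdot> (f \<otimes> h)"
    "h \<otimes> (g \<cdot> f) = (\<I> (Cod C h) \<otimes> g) \<cdot> (h \<otimes> f)"
  using assms by (simp_all add: interchange)

lemmas slices = Ident_Tensor comp_assoc Tensor_assoc comp_whisker

lemma braiding_nat:
  assumes "f \<in> Arr C" "g \<in> Arr C" "Cod C f = X'" "Cod C g = Y'"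
  shows "\<c> X' Y' \<cdot> (f \<otimes> g) = (g \<otimes> f) \<cdot> \<c> (Dom C f) (Dom C g)"
  using Braiding_natural[of f "Dom C f" X' g "Dom C g" Y'] assms by (simp add: Hom_iff)

lemma Ident_Tensor_Comp [simp]:
  assumes "f \<in> Arr C" "X \<in> Obj C" "Y \<in> Obj C"
  shows "Cod C f = X \<otimes>\<^sub>o Y \<Longrightarrow> (\<I> X \<otimes> \<I> Y) \<cdot> f = f"
    "Dom C f = X \<otimes>\<^sub>o Y \<Longrightarrow> f \<cdot> (\<I> X \<otimes> \<I> Y) = f"
  using assms by (simp_all add: Tensor_Ident)

lemma braiding_nat_rev:
  assumes "f \<in> Arr C" "g \<in> Arr C" "Dom C f = X" "Dom C g = Y"
  shows "(g \<otimes> f) \<cdot> \<c> X Y = \<c> (Cod C f) (Cod C g) \<cdot> (f \<otimes> g)"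
  using assms by (simp add: braiding_nat)

text \<open>The hexagon makes \<open>\<c> X \<K>\<close> idempotent, and an invertible idempotent is an identity.\<close>

lemma Braiding_Unit [simp]:
  assumes X: "X \<in> Obj C"
  shows "\<c> X \<K> = \<I> X" "\<c> \<K> X = \<I> X"
proof -
  have idem: "e = \<I> X" if e: "e \<in> Hom X X" "e = e \<cdot> e" and d: "d \<in> Hom X X" "d \<cdot> e = \<I> X" for e d
  proof -
    have "e = (d \<cdot> e) \<cdot> e" using e d X by (simp add: Hom_iff)
    also have "\<dots> = d \<cdot> (e \<cdot> e)" using e(1) d(1) by (subst comp_assoc) (auto simp: Hom_iff)
    finally show ?thesis using e d by simp
  qed
  obtain d where d: "d \<in> Hom X X" "d \<cdot> \<c> X \<K> = \<I> X"
    using Braiding_iso[OF X Unit_Obj_in_Obj] X by auto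
  show "\<c> X \<K> = \<I> X"
    using idem[OF _ _ d] hexagon_right[of X \<K> \<K>] X by (simp add: Hom_iff)
  obtain d where d: "d \<in> Hom X X" "d \<cdot> \<c> \<K> X = \<I> X"
    using Braiding_iso[OF Unit_Obj_in_Obj X] X by auto
  show "\<c> \<K> X = \<I> X"
    using idem[OF _ _ d] hexagon_left[of \<K> \<K> X] X by (simp add: Hom_iff)
qed

section \<open>Tensor products of coalgebras and of algebras\<close>

lemma tensor_coalgebra_sel [simp]:
  "carr (tensor_coalgebra C D E) = carr D \<otimes>\<^sub>o carr E"
  "counit (tensor_coalgebra C D E) = \<epsilon>\<^bsub>D\<^esub> \<otimes> \<epsilon>\<^bsub>E\<^esub>"
  by (simp_all add: tensor_coalgebra_def)

lemma coalgebra_typing: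
  assumes "is_coalgebra C D"
  shows "carr D \<in> Obj C" "\<epsilon>\<^bsub>D\<^esub> \<in> Arr C" "Dom C \<epsilon>\<^bsub>D\<^esub> = carr D" "Cod C \<epsilon>\<^bsub>D\<^esub> = \<K>"
   "\<delta>\<^bsub>D\<^esub> \<in> Arr C" "Dom C \<delta>\<^bsub>D\<^esub> = carr D" "Cod C \<delta>\<^bsub>D\<^esub> = carr D \<otimes>\<^sub>o carr D"
  using assms by (auto simp: is_coalgebra_def Hom_iff)

lemma tensor_coprod:
  "coprod (tensor_coalgebra C D E) =
    (\<I> (carr D) \<otimes> \<c> (carr D) (carr E) \<otimes> \<I> (carr E)) \<cdot> (\<delta>\<^bsub>D\<^esub> \<otimes> \<delta>\<^bsub>E\<^esub>)"
  by (simp add: tensor_coalgebra_def)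

lemma tensor_is_coalgebra:
  assumes D: "is_coalgebra C D" and E: "is_coalgebra C E"
  shows "is_coalgebra C (tensor_coalgebra C D E)"
proof -
  let ?X = "carr D" and ?Y = "carr E" and ?d = "\<delta>\<^bsub>D\<^esub>" and ?e = "\<delta>\<^bsub>E\<^esub>"
  note [simp] = coalgebra_typing[OF D] coalgebra_typing[OF E]
  let ?T = "coprod (tensor_coalgebra C D E)"
  let ?s = "\<I> ?X \<otimes> \<c> ?X ?Y \<otimes> \<I> ?Y"
  have eqD: "(\<epsilon>\<^bsub>D\<^esub> \<otimes> \<I> ?X) \<cdot> ?d = \<I> ?X" "(\<I> ?X \<otimes> \<epsilon>\<^bsub>D\<^esub>) \<cdot> ?d = \<I> ?X"
      "(?d \<otimes> \<I> ?X) \<cdot> ?d = (\<I> ?X \<otimes> ?d) \<cdot> ?d"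
    and eqE: "(\<epsilon>\<^bsub>E\<^esub> \<otimes> \<I> ?Y) \<cdot> ?e = \<I> ?Y" "(\<I> ?Y \<otimes> \<epsilon>\<^bsub>E\<^esub>) \<cdot> ?e = \<I> ?Y"
      "(?e \<otimes> \<I> ?Y) \<cdot> ?e = (\<I> ?Y \<otimes> ?e) \<cdot> ?e"
    using D E by (auto simp: is_coalgebra_def)
  have [simp]: "\<I> (?X \<otimes>\<^sub>o ?Y) = \<I> ?X \<otimes> \<I> ?Y" by (simp add: Tensor_Ident)
  have T: "?T \<in> Hom (?X \<otimes>\<^sub>o ?Y) ((?X \<otimes>\<^sub>o ?Y) \<otimes>\<^sub>o ?X \<otimes>\<^sub>o ?Y)"
    by (simp add: tensor_coprod Hom_iff)
  have counits: "((\<epsilon>\<^bsub>D\<^esub> \<otimes> \<epsilon>\<^bsub>E\<^esub>) \<otimes> \<I> (?X \<otimes>\<^sub>o ?Y)) \<cdot> ?T = \<I> (?X \<otimes>\<^sub>o ?Y)"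
     "(\<I> (?X \<otimes>\<^sub>o ?Y) \<otimes> (\<epsilon>\<^bsub>D\<^esub> \<otimes> \<epsilon>\<^bsub>E\<^esub>)) \<cdot> ?T = \<I> (?X \<otimes>\<^sub>o ?Y)"
    by (simp_all add: tensor_coprod merge braiding_nat_rev eqD eqE)
  \<comment> \<open>Both sides of coassociativity are brought to the form: braidings after iterated coproducts.
    The two braidings agree by the hexagons.\<close>
  let ?XYY = "\<c> ?X (?Y \<otimes>\<^sub>o ?Y)" and ?XXY = "\<c> (?X \<otimes>\<^sub>o ?X) ?Y"
  have l1: "(?d \<otimes> ?e \<otimes> \<I> ?X \<otimes> \<I> ?Y) \<cdot> ?s =
    (\<I> ?X \<otimes> \<I> ?X \<otimes> ?XYY \<otimes> \<I> ?Y) \<cdot> (?d \<otimes> \<I> ?X \<otimes> ?e \<otimes> \<I> ?Y)"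
    by (simp add: merge braiding_nat_rev)
  have l2: "(?d \<otimes> \<I> ?X \<otimes> ?e \<otimes> \<I> ?Y) \<cdot> (?d \<otimes> ?e) = ((?d \<otimes> \<I> ?X) \<cdot> ?d) \<otimes> ((?e \<otimes> \<I> ?Y) \<cdot> ?e)"
    by (simp add: merge)
  have r1: "(\<I> ?X \<otimes> \<I> ?Y \<otimes> ?d \<otimes> ?e) \<cdot> ?s =
    (\<I> ?X \<otimes> ?XXY \<otimes> \<I> ?Y \<otimes> \<I> ?Y) \<cdot> (\<I> ?X \<otimes> ?d \<otimes> \<I> ?Y \<otimes> ?e)"
    by (simp add: merge braiding_nat_rev)
  have r2: "(\<I> ?X \<otimes> ?d \<otimes> \<I> ?Y \<otimes> ?e) \<cdot> (?d \<otimes> ?e) = ((\<I> ?X \<otimes> ?d) \<cdot> ?d) \<otimes> ((\<I> ?Y \<otimes> ?e) \<cdot> ?e)"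
    by (simp add: merge)
  have br: "(\<I> ?X \<otimes> \<c> ?X ?Y \<otimes> \<I> ?Y \<otimes> \<I> ?X \<otimes> \<I> ?Y) \<cdot> (\<I> ?X \<otimes> \<I> ?X \<otimes> ?XYY \<otimes> \<I> ?Y) =
     (\<I> ?X \<otimes> \<I> ?Y \<otimes> ?s) \<cdot> (\<I> ?X \<otimes> ?XXY \<otimes> \<I> ?Y \<otimes> \<I> ?Y)"
  proof -
    have "(\<I> ?X \<otimes> \<c> ?X ?Y \<otimes> \<I> ?Y \<otimes> \<I> ?X \<otimes> \<I> ?Y) \<cdot> (\<I> ?X \<otimes> \<I> ?X \<otimes> \<I> ?Y \<otimes> \<c> ?X ?Y \<otimes> \<I> ?Y) =
       (\<I> ?X \<otimes> \<I> ?Y \<otimes> \<I> ?X \<otimes> \<c> ?X ?Y \<otimes> \<I> ?Y) \<cdot> (\<I> ?X \<otimes> \<c> ?X ?Y \<otimes> \<I> ?X \<otimes> \<I> ?Y \<otimes> \<I> ?Y)"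
      by (simp add: merge)
    from comp_left[OF this] show ?thesis
      by (simp add: slices hexagon_left hexagon_right)
  qed
  have "(?T \<otimes> \<I> (?X \<otimes>\<^sub>o ?Y)) \<cdot> ?T =
      (?s \<otimes> \<I> ?X \<otimes> \<I> ?Y) \<cdot> ((\<I> ?X \<otimes> \<I> ?X \<otimes> ?XYY \<otimes> \<I> ?Y) \<cdot>
        (((?d \<otimes> \<I> ?X) \<cdot> ?d) \<otimes> ((?e \<otimes> \<I> ?Y) \<cdot> ?e)))"
    by (simp add: tensor_coprod slices comp_left[OF l1] flip: l2)
  also have "\<dots> = (\<I> ?X \<otimes> \<I> ?Y \<otimes> ?s) \<cdot> ((\<I> ?X \<otimes> ?XXY \<otimes> \<I> ?Y \<otimes> \<I> ?Y) \<cdot>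
        (((\<I> ?X \<otimes> ?d) \<cdot> ?d) \<otimes> ((\<I> ?Y \<otimes> ?e) \<cdot> ?e)))"
    by (simp add: comp_left[OF br] comp_assoc Tensor_assoc eqD eqE)
  also have "\<dots> = (\<I> (?X \<otimes>\<^sub>o ?Y) \<otimes> ?T) \<cdot> ?T"
    by (simp add: tensor_coprod slices comp_left[OF r1] flip: r2)
  finally show ?thesis
    using T counits by (simp add: is_coalgebra_def Hom_iff)
qed

lemma tensor_coalgebra_assoc:
  assumes D: "is_coalgebra C D" and E: "is_coalgebra C E" and F: "is_coalgebra C F"
  shows "tensor_coalgebra C (tensor_coalgebra C D E) F =
    tensor_coalgebra C D (tensor_coalgebra C E F)"
proof -
  let ?X = "carr D" and ?Y = "carr E" and ?Z = "carr F"
  note [simp] = coalgebra_typing[OF D] coalgebra_typing[OF E] coalgebra_typing[OF F]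
  have 1: "(\<I> ?X \<otimes> \<I> ?Y \<otimes> \<I> ?X \<otimes> \<c> ?Y ?Z \<otimes> \<I> ?Z) \<cdot> (\<I> ?X \<otimes> \<c> ?X ?Y \<otimes> \<I> ?Y \<otimes> \<I> ?Z \<otimes> \<I> ?Z) =
      (\<I> ?X \<otimes> \<c> ?X ?Y \<otimes> \<I> ?Z \<otimes> \<I> ?Y \<otimes> \<I> ?Z) \<cdot> (\<I> ?X \<otimes> \<I> ?X \<otimes> \<I> ?Y \<otimes> \<c> ?Y ?Z \<otimes> \<I> ?Z)"
    by (simp add: merge)
  show ?thesis
    by (simp add: tensor_coalgebra_def hexagon_left hexagon_right slices comp_left[OF 1])
qed

lemma coalgebra_mor_Hom: "coalgebra_mor C D E f \<Longrightarrow> f \<in> Hom (carr D) (carr E)"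
  by (simp add: coalgebra_mor_def)

lemma coalgebra_mor_typing:
  assumes "coalgebra_mor C D E f"
  shows "f \<in> Arr C" "Dom C f = carr D" "Cod C f = carr E"
  using assms by (auto simp: coalgebra_mor_def Hom_iff)

lemma coalgebra_mor_Ident: "is_coalgebra C D \<Longrightarrow> coalgebra_mor C D D (\<I> (carr D))"
  by (simp add: coalgebra_mor_def coalgebra_typing Hom_iff Tensor_Ident)

lemma coalgebra_mor_Comp:
  assumes D: "is_coalgebra C D" and E: "is_coalgebra C E" and F: "is_coalgebra C F"
    and f: "coalgebra_mor C D E f" and g: "coalgebra_mor C E F g"
  shows "coalgebra_mor C D F (g \<cdot> f)"
proof -
  note [simp] = coalgebra_typing[OF D] coalgebra_typing[OF E] coalgebra_typing[OF F]
    coalgebra_mor_typing[OF f] coalgebra_mor_typing[OF g]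
  have e: "\<epsilon>\<^bsub>E\<^esub> \<cdot> f = \<epsilon>\<^bsub>D\<^esub>" "\<epsilon>\<^bsub>F\<^esub> \<cdot> g = \<epsilon>\<^bsub>E\<^esub>" "\<delta>\<^bsub>E\<^esub> \<cdot> f = (f \<otimes> f) \<cdot> \<delta>\<^bsub>D\<^esub>"
    "\<delta>\<^bsub>F\<^esub> \<cdot> g = (g \<otimes> g) \<cdot> \<delta>\<^bsub>E\<^esub>"
    using f g by (auto simp: coalgebra_mor_def)
  show ?thesis
    by (simp add: coalgebra_mor_def Hom_iff e merge comp_left[OF e(2)] comp_left[OF e(4)])
qed

lemma coalgebra_mor_Tensor:
  assumes D: "is_coalgebra C D" and E: "is_coalgebra C E"
    and D': "is_coalgebra C D'" and E': "is_coalgebra C E'"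
    and f: "coalgebra_mor C D D' f" and g: "coalgebra_mor C E E' g"
  shows "coalgebra_mor C (tensor_coalgebra C D E) (tensor_coalgebra C D' E') (f \<otimes> g)"
proof -
  note [simp] = coalgebra_typing[OF D] coalgebra_typing[OF E] coalgebra_typing[OF D']
    coalgebra_typing[OF E'] coalgebra_mor_typing[OF f] coalgebra_mor_typing[OF g]
  have e: "\<epsilon>\<^bsub>D'\<^esub> \<cdot> f = \<epsilon>\<^bsub>D\<^esub>" "\<delta>\<^bsub>D'\<^esub> \<cdot> f = (f \<otimes> f) \<cdot> \<delta>\<^bsub>D\<^esub>"
    "\<epsilon>\<^bsub>E'\<^esub> \<cdot> g = \<epsilon>\<^bsub>E\<^esub>" "\<delta>\<^bsub>E'\<^esub> \<cdot> g = (g \<otimes> g) \<cdot> \<delta>\<^bsub>E\<^esub>"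
    using f g by (auto simp: coalgebra_mor_def)
  have 1: "(\<delta>\<^bsub>D'\<^esub> \<otimes> \<delta>\<^bsub>E'\<^esub>) \<cdot> (f \<otimes> g) = (f \<otimes> f \<otimes> g \<otimes> g) \<cdot> (\<delta>\<^bsub>D\<^esub> \<otimes> \<delta>\<^bsub>E\<^esub>)"
    by (simp add: merge e)
  have 3: "(\<epsilon>\<^bsub>D'\<^esub> \<otimes> \<epsilon>\<^bsub>E'\<^esub>) \<cdot> (f \<otimes> g) = \<epsilon>\<^bsub>D\<^esub> \<otimes> \<epsilon>\<^bsub>E\<^esub>"
    by (simp add: interchange e)
  have 2: "(f \<otimes> g \<otimes> f \<otimes> g) \<cdot> (\<I> (carr D) \<otimes> \<c> (carr D) (carr E) \<otimes> \<I> (carr E)) =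
    (\<I> (carr D') \<otimes> \<c> (carr D') (carr E') \<otimes> \<I> (carr E')) \<cdot> (f \<otimes> f \<otimes> g \<otimes> g)"
    by (simp add: merge braiding_nat)
  show ?thesis
    by (simp add: coalgebra_mor_def Hom_iff tensor_coprod 1 3 comp_assoc comp_left[OF 2]
       Tensor_assoc)
qed

lemma unit_coalgebra_sel [simp]:
  "carr (unit_coalgebra C) = \<K>" "counit (unit_coalgebra C) = \<I> \<K>" "coprod (unit_coalgebra C) = \<I> \<K>"
  by (simp_all add: unit_coalgebra_def)

lemma unit_is_coalgebra: "is_coalgebra C (unit_coalgebra C)"
  by (simp add: is_coalgebra_def Hom_iff)

lemma coalgebra_mor_counit:
  assumes D: "is_coalgebra C D"
  shows "coalgebra_mor C D (unit_coalgebra C) \<epsilon>\<^bsub>D\<^esub>"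
proof -
  note [simp] = coalgebra_typing[OF D]
  have "(\<epsilon>\<^bsub>D\<^esub> \<otimes> \<epsilon>\<^bsub>D\<^esub>) \<cdot> \<delta>\<^bsub>D\<^esub> = ((\<epsilon>\<^bsub>D\<^esub> \<otimes> \<I> \<K>) \<cdot> (\<I> (carr D) \<otimes> \<epsilon>\<^bsub>D\<^esub>)) \<cdot> \<delta>\<^bsub>D\<^esub>"
    by (subst interchange) simp_all
  also have "\<dots> = \<epsilon>\<^bsub>D\<^esub> \<cdot> ((\<I> (carr D) \<otimes> \<epsilon>\<^bsub>D\<^esub>) \<cdot> \<delta>\<^bsub>D\<^esub>)"
    by (simp add: comp_assoc)
  also have "\<dots> = \<epsilon>\<^bsub>D\<^esub>"
    using D by (simp add: is_coalgebra_def)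
  finally show ?thesis by (simp add: coalgebra_mor_def Hom_iff)
qed

text \<open>The tensor product with the unit coalgebra has the same data as \<open>D\<close>; equality of records is not
claimed, because \<open>D\<close> may carry further fields.\<close>

lemma tensor_unit_coalgebra:
  assumes D: "is_coalgebra C D"
  shows "carr (tensor_coalgebra C D (unit_coalgebra C)) = carr D"
    "counit (tensor_coalgebra C D (unit_coalgebra C)) = \<epsilon>\<^bsub>D\<^esub>"
    "coprod (tensor_coalgebra C D (unit_coalgebra C)) = \<delta>\<^bsub>D\<^esub>"
  using coalgebra_typing[OF D]
  by (simp_all add: tensor_coprod Tensor_Ident)

end

text \<open>Reversing all arrows; the braiding of \<open>X\<close> and \<open>Y\<close> in the opposite category is the arrow
\<open>\<c> Y X\<close>, not an inverse. This choice makes the tensor product of algebras, with product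
\<open>(\<mu> \<otimes> \<mu>) \<cdot> (X \<otimes> \<c> \<otimes> X)\<close>, the dual of the tensor product of coalgebras.\<close>

definition opposite ::
    "('o, 'a, 'z) braided_category_scheme \<Rightarrow> ('o, 'a, 'z) braided_category_scheme" where
  "opposite C = C\<lparr>Dom := Cod C, Cod := Dom C, Comp := (\<lambda>g f. f \<cdot>\<^bsub>C\<^esub> g),
    Braiding := (\<lambda>X Y. \<c>\<^bsub>C\<^esub> Y X)\<rparr>"

lemma opposite_sel [simp]:
  "Obj (opposite C) = Obj C" "Arr (opposite C) = Arr C"
  "Dom (opposite C) = Cod C" "Cod (opposite C) = Dom C"
  "Ident (opposite C) = Ident C" "Comp (opposite C) g f = f \<cdot>\<^bsub>C\<^esub> g"
  "Tensor_Obj (opposite C) = Tensor_Obj C" "Tensor (opposite C) = Tensor C"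
  "Unit_Obj (opposite C) = Unit_Obj C" "Braiding (opposite C) X Y = \<c>\<^bsub>C\<^esub> Y X"
  by (simp_all add: opposite_def)

lemma Hom_opposite [simp]: "Hom\<^bsub>opposite C\<^esub> X Y = Hom\<^bsub>C\<^esub> Y X"
  by (auto simp: Hom_iff)

text \<open>Unital associative algebras on the object \<open>X\<close> with product \<open>\<pi>\<close> and unit \<open>\<iota>\<close>, as coalgebras
in the opposite category.\<close>

definition is_algebra :: "('o, 'a, 'z) braided_category_scheme \<Rightarrow> 'o \<Rightarrow> 'a \<Rightarrow> 'a \<Rightarrow> bool" where
  "is_algebra C X \<pi> \<iota> \<longleftrightarrow> is_coalgebra (opposite C) \<lparr>carr = X, counit = \<iota>, coprod = \<pi>\<rparr>"

section \<open>Convolution\<close>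

text \<open>The convolution product of two arrows from a coalgebra \<open>D\<close> into an object with product \<open>\<pi>\<close>. For an
algebra with unit \<open>\<iota>\<close> it makes the arrows from \<open>D\<close> a monoid with unit \<open>\<iota> \<cdot> \<epsilon>\<close>; precomposition with
coalgebra morphisms and composition with multiplicative arrows preserve it.\<close>

definition convolution ::
    "('o, 'a, 'z) braided_category_scheme \<Rightarrow> ('o, 'a, 'y) coalgebra_scheme \<Rightarrow> 'a \<Rightarrow> 'a \<Rightarrow> 'a \<Rightarrow> 'a" where
  "convolution C D \<pi> f g = \<pi> \<cdot>\<^bsub>C\<^esub> ((f \<otimes>\<^bsub>C\<^esub> g) \<cdot>\<^bsub>C\<^esub> \<delta>\<^bsub>D\<^esub>)"

context strict_braided_monoidal_category
begin

lemma opposite_is_braided: "strict_braided_monoidal_category (opposite C)"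
proof unfold_locales
  fix f g h X Y Z W
  assume "f \<in> Hom\<^bsub>opposite C\<^esub> X Y" "g \<in> Hom\<^bsub>opposite C\<^esub> Y Z" "h \<in> Hom\<^bsub>opposite C\<^esub> Z W"
  then show "h \<cdot>\<^bsub>opposite C\<^esub> (g \<cdot>\<^bsub>opposite C\<^esub> f) = (h \<cdot>\<^bsub>opposite C\<^esub> g) \<cdot>\<^bsub>opposite C\<^esub> f"
    by (simp add: Hom_iff comp_assoc)
next
  fix X Y assume "X \<in> Obj (opposite C)" "Y \<in> Obj (opposite C)"
  then show "\<exists>d \<in> Hom\<^bsub>opposite C\<^esub> (Y \<otimes>\<^sub>o\<^bsub>opposite C\<^esub> X) (X \<otimes>\<^sub>o\<^bsub>opposite C\<^esub> Y).
      d \<cdot>\<^bsub>opposite C\<^esub> \<c>\<^bsub>opposite C\<^esub> X Y = \<I>\<^bsub>opposite C\<^esub> (X \<otimes>\<^sub>o\<^bsub>opposite C\<^esub> Y) \<and>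
      \<c>\<^bsub>opposite C\<^esub> X Y \<cdot>\<^bsub>opposite C\<^esub> d = \<I>\<^bsub>opposite C\<^esub> (Y \<otimes>\<^sub>o\<^bsub>opposite C\<^esub> X)"
    using Braiding_iso[of Y X] by auto
qed (auto simp: Hom_iff interchange Tensor_Ident Tensor_assoc braiding_nat hexagon_left hexagon_right)

lemma is_algebra_iff:
  "is_algebra C X \<pi> \<iota> \<longleftrightarrow> X \<in> Obj C \<and> \<iota> \<in> Hom \<K> X \<and> \<pi> \<in> Hom (X \<otimes>\<^sub>o X) X \<and>
    \<pi> \<cdot> (\<iota> \<otimes> \<I> X) = \<I> X \<and> \<pi> \<cdot> (\<I> X \<otimes> \<iota>) = \<I> X \<and>
    \<pi> \<cdot> (\<pi> \<otimes> \<I> X) = \<pi> \<cdot> (\<I> X \<otimes> \<pi>)"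
  by (simp add: is_algebra_def is_coalgebra_def)

lemma algebra_typing:
  assumes "is_algebra C X \<pi> \<iota>"
  shows "X \<in> Obj C" "\<iota> \<in> Arr C" "Dom C \<iota> = \<K>" "Cod C \<iota> = X"
   "\<pi> \<in> Arr C" "Dom C \<pi> = X \<otimes>\<^sub>o X" "Cod C \<pi> = X"
  using assms by (auto simp: is_algebra_iff Hom_iff)

lemma tensor_is_algebra:
  assumes "is_algebra C X \<pi> \<iota>"
  shows "is_algebra C (X \<otimes>\<^sub>o X) ((\<pi> \<otimes> \<pi>) \<cdot> (\<I> X \<otimes> \<c> X X \<otimes> \<I> X)) (\<iota> \<otimes> \<iota>)"
  using strict_braided_monoidal_category.tensor_is_coalgebra
    [OF opposite_is_braided assms[unfolded is_algebra_def] assms[unfolded is_algebra_def]]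
  by (simp add: is_algebra_def tensor_coalgebra_def)

lemma convolution_in_Hom:
  assumes D: "is_coalgebra C D" and A: "is_algebra C X \<pi> \<iota>"
    and f: "f \<in> Hom (carr D) X" and g: "g \<in> Hom (carr D) X"
  shows "convolution C D \<pi> f g \<in> Hom (carr D) X"
  using f g coalgebra_typing[OF D] algebra_typing[OF A]
  by (simp add: convolution_def Hom_iff)

lemma convolution_assoc:
  assumes D: "is_coalgebra C D" and A: "is_algebra C X \<pi> \<iota>"
    and f: "f \<in> Hom (carr D) X" and g: "g \<in> Hom (carr D) X" and h: "h \<in> Hom (carr D) X"
  shows "convolution C D \<pi> (convolution C D \<pi> f g) h = convolution C D \<pi> f (convolution C D \<pi> g h)"
proof -
  note [simp] = coalgebra_typing[OF D] algebra_typing[OF A]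
    f[unfolded Hom_iff] g[unfolded Hom_iff] h[unfolded Hom_iff]
  have "convolution C D \<pi> (convolution C D \<pi> f g) h =
      \<pi> \<cdot> ((\<pi> \<otimes> \<I> X) \<cdot> ((f \<otimes> g \<otimes> h) \<cdot> ((\<delta>\<^bsub>D\<^esub> \<otimes> \<I> (carr D)) \<cdot> \<delta>\<^bsub>D\<^esub>)))"
    by (simp add: convolution_def merge)
  also have "\<dots> = (\<pi> \<cdot> (\<pi> \<otimes> \<I> X)) \<cdot> ((f \<otimes> g \<otimes> h) \<cdot> ((\<delta>\<^bsub>D\<^esub> \<otimes> \<I> (carr D)) \<cdot> \<delta>\<^bsub>D\<^esub>))"
    by (simp add: comp_assoc)
  also have "\<dots> = (\<pi> \<cdot> (\<I> X \<otimes> \<pi>)) \<cdot> ((f \<otimes> g \<otimes> h) \<cdot> ((\<I> (carr D) \<otimes> \<delta>\<^bsub>D\<^esub>) \<cdot> \<delta>\<^bsub>D\<^esub>))"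
    using D A by (simp only: is_coalgebra_def is_algebra_iff)
  also have "\<dots> = convolution C D \<pi> f (convolution C D \<pi> g h)"
    by (simp add: convolution_def merge)
  finally show ?thesis .
qed

lemma convolution_unit:
  assumes D: "is_coalgebra C D" and A: "is_algebra C X \<pi> \<iota>" and f: "f \<in> Hom (carr D) X"
  shows "convolution C D \<pi> (\<iota> \<cdot> \<epsilon>\<^bsub>D\<^esub>) f = f" "convolution C D \<pi> f (\<iota> \<cdot> \<epsilon>\<^bsub>D\<^esub>) = f"
proof -
  note [simp] = coalgebra_typing[OF D] algebra_typing[OF A] f[unfolded Hom_iff]
  have "(\<iota> \<cdot> \<epsilon>\<^bsub>D\<^esub>) \<otimes> f = (\<iota> \<otimes> \<I> X) \<cdot> (f \<cdot> (\<epsilon>\<^bsub>D\<^esub> \<otimes> \<I> (carr D)))"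
    using interchange[of "\<epsilon>\<^bsub>D\<^esub>" "\<I> \<K>" "\<I> (carr D)" f] by (simp add: interchange)
  then have "convolution C D \<pi> (\<iota> \<cdot> \<epsilon>\<^bsub>D\<^esub>) f =
      (\<pi> \<cdot> (\<iota> \<otimes> \<I> X)) \<cdot> (f \<cdot> ((\<epsilon>\<^bsub>D\<^esub> \<otimes> \<I> (carr D)) \<cdot> \<delta>\<^bsub>D\<^esub>))"
    by (simp add: convolution_def comp_assoc)
  then show "convolution C D \<pi> (\<iota> \<cdot> \<epsilon>\<^bsub>D\<^esub>) f = f"
    using D A by (simp add: is_coalgebra_def is_algebra_iff)
  have "f \<otimes> (\<iota> \<cdot> \<epsilon>\<^bsub>D\<^esub>) = (\<I> X \<otimes> \<iota>) \<cdot> (f \<cdot> (\<I> (carr D) \<otimes> \<epsilon>\<^bsub>D\<^esub>))"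
    using interchange[of "\<I> (carr D)" f "\<epsilon>\<^bsub>D\<^esub>" "\<I> \<K>"] by (simp add: interchange)
  then have "convolution C D \<pi> f (\<iota> \<cdot> \<epsilon>\<^bsub>D\<^esub>) =
      (\<pi> \<cdot> (\<I> X \<otimes> \<iota>)) \<cdot> (f \<cdot> ((\<I> (carr D) \<otimes> \<epsilon>\<^bsub>D\<^esub>) \<cdot> \<delta>\<^bsub>D\<^esub>))"
    by (simp add: convolution_def comp_assoc)
  then show "convolution C D \<pi> f (\<iota> \<cdot> \<epsilon>\<^bsub>D\<^esub>) = f"
    using D A by (simp add: is_coalgebra_def is_algebra_iff)
qed

lemma convolution_inverse_unique:
  assumes D: "is_coalgebra C D" and A: "is_algebra C X \<pi> \<iota>"
    and f: "f \<in> Hom (carr D) X" and g: "g \<in> Hom (carr D) X" and h: "h \<in> Hom (carr D) X"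
    and "convolution C D \<pi> f g = \<iota> \<cdot> \<epsilon>\<^bsub>D\<^esub>" "convolution C D \<pi> g h = \<iota> \<cdot> \<epsilon>\<^bsub>D\<^esub>"
  shows "f = h"
  using convolution_assoc[OF D A f g h] assms convolution_unit[OF D A] by simp

lemma convolution_Comp:
  assumes D: "is_coalgebra C D" and E: "is_coalgebra C E" and A: "is_algebra C X \<pi> \<iota>"
    and f: "f \<in> Hom (carr E) X" and g: "g \<in> Hom (carr E) X"
    and p: "coalgebra_mor C D E p"
  shows "convolution C E \<pi> f g \<cdot> p = convolution C D \<pi> (f \<cdot> p) (g \<cdot> p)"
proof -
  note [simp] = coalgebra_typing[OF D] coalgebra_typing[OF E] algebra_typing[OF A]
    coalgebra_mor_typing[OF p] f[unfolded Hom_iff] g[unfolded Hom_iff]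
  have "\<delta>\<^bsub>E\<^esub> \<cdot> p = (p \<otimes> p) \<cdot> \<delta>\<^bsub>D\<^esub>" using p by (simp add: coalgebra_mor_def)
  then show ?thesis by (simp add: convolution_def merge)
qed

lemma Comp_convolution:
  assumes D: "is_coalgebra C D" and A: "is_algebra C X \<pi> \<iota>" and B: "is_algebra C Y \<pi>' \<iota>'"
    and f: "f \<in> Hom (carr D) X" and g: "g \<in> Hom (carr D) X"
    and h: "h \<in> Hom X Y" "h \<cdot> \<pi> = \<pi>' \<cdot> (h \<otimes> h)"
  shows "h \<cdot> convolution C D \<pi> f g = convolution C D \<pi>' (h \<cdot> f) (h \<cdot> g)"
proof -
  note [simp] = coalgebra_typing[OF D] algebra_typing[OF A] algebra_typing[OF B]
    f[unfolded Hom_iff] g[unfolded Hom_iff] h(1)[unfolded Hom_iff]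
  show ?thesis by (simp add: convolution_def merge comp_left[OF h(2)])
qed

end

section \<open>Convolution into a Hopf algebra\<close>

locale hopf_algebra_in_category = strict_braided_monoidal_category C
  for C :: "('o, 'a, 'z) braided_category_scheme" (structure) +
  fixes A :: "('o, 'a) hopf_algebra"
  assumes hopf: "is_hopf_algebra C A"
begin

text \<open>Short names for the constituents of the Hopf algebra \<open>A\<close>; \<open>HH\<close> is the tensor square coalgebra, \<open>mu2\<close> the
product of the tensor square algebra, and \<open>conv\<close> and \<open>conv2\<close> are convolution into \<open>H\<close> and \<open>H \<otimes> H\<close>.\<close>

abbreviation "H \<equiv> carr A"
abbreviation "mu \<equiv> mult A"
abbreviation "eta \<equiv> unity A"
abbreviation "del \<equiv> coprod A"
abbreviation "eps \<equiv> counit A"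
abbreviation "lam \<equiv> antipode A"
abbreviation "mu2 \<equiv> (mu \<otimes> mu) \<cdot> (\<I> H \<otimes> \<c> H H \<otimes> \<I> H)"
abbreviation "conv D \<equiv> convolution C D mu"
abbreviation "conv2 D \<equiv> convolution C D mu2"
abbreviation "HH \<equiv> tensor_coalgebra C A A"

lemma coalg: "is_coalgebra C A"
  using hopf by (simp add: is_hopf_algebra_def is_nonunital_bialgebra_def)

lemmas coalg_simps [simp] = coalgebra_typing[OF coalg]

lemma coalg_HH: "is_coalgebra C HH"
  by (rule tensor_is_coalgebra[OF coalg coalg])

lemma mu_coalgebra_mor: "coalgebra_mor C HH A mu" and eta_coalgebra_mor: "coalgebra_mor C (unit_coalgebra C) A eta"
  using hopf by (simp_all add: is_hopf_algebra_def is_nonunital_bialgebra_def)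

lemma alg: "is_algebra C H mu eta"
  using hopf by (simp add: is_hopf_algebra_def is_nonunital_bialgebra_def is_algebra_iff coalgebra_mor_def)

lemmas alg_simps [simp] = algebra_typing[OF alg]

lemma alg2: "is_algebra C (H \<otimes>\<^sub>o H) mu2 (eta \<otimes> eta)"
  by (rule tensor_is_algebra[OF alg])

lemma unit_laws: "mu \<cdot> (eta \<otimes> \<I> H) = \<I> H" "mu \<cdot> (\<I> H \<otimes> eta) = \<I> H"
  using alg by (simp_all add: is_algebra_iff)

lemma counit_laws: "(eps \<otimes> \<I> H) \<cdot> del = \<I> H" "(\<I> H \<otimes> eps) \<cdot> del = \<I> H"
  using coalg by (simp_all add: is_coalgebra_def)

lemma lam_typing [simp]: "lam \<in> Arr C" "Dom C lam = H" "Cod C lam = H"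
  using hopf by (auto simp: is_hopf_algebra_def Hom_iff)

lemma lam_inverse:
  "convolution C A mu lam (\<I> H) = eta \<cdot> eps" "convolution C A mu (\<I> H) lam = eta \<cdot> eps"
  using hopf by (simp_all add: is_hopf_algebra_def convolution_def comp_assoc)

lemma mu_eta_eta: "mu \<cdot> (eta \<otimes> eta) = eta"
proof -
  have "eta \<otimes> eta = (eta \<otimes> \<I> H) \<cdot> eta"
    using interchange[of "\<I> \<K>" eta eta "\<I> H"] by simp
  then show ?thesis using comp_left[OF unit_laws(1), of eta] by simp
qed

lemma counit_coprod_mu: "eps \<cdot> mu = eps \<otimes> eps" "del \<cdot> mu = mu2 \<cdot> (del \<otimes> del)"
  using mu_coalgebra_mor by (simp_all add: coalgebra_mor_def tensor_coprod comp_assoc)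

lemma counit_coprod_eta: "eps \<cdot> eta = \<I> \<K>" "del \<cdot> eta = eta \<otimes> eta"
  using eta_coalgebra_mor by (simp_all add: coalgebra_mor_def)

text \<open>The two embeddings of \<open>H\<close> into the tensor square algebra, applied to an arrow into \<open>H\<close>. Both are algebra
morphisms; their product in the order \<open>inl\<close>, \<open>inr\<close> is the identity of \<open>H \<otimes> H\<close>, and in the
opposite order it is the braiding. In other words, the braiding measures how far the two copies of
\<open>H\<close> are from commuting.\<close>

abbreviation inl :: "'a \<Rightarrow> 'a" where "inl f \<equiv> (\<I> H \<otimes> eta) \<cdot> f"
abbreviation inr :: "'a \<Rightarrow> 'a" where "inr f \<equiv> (eta \<otimes> \<I> H) \<cdot> f"

lemma inl_mult: "(\<I> H \<otimes> eta) \<cdot> mu = mu2 \<cdot> ((\<I> H \<otimes> eta) \<otimes> (\<I> H \<otimes> eta))"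
proof -
  have "mu2 \<cdot> ((\<I> H \<otimes> eta) \<otimes> (\<I> H \<otimes> eta)) = (mu \<otimes> mu) \<cdot> (\<I> H \<otimes> \<I> H \<otimes> eta \<otimes> eta)"
    by (simp add: merge braiding_nat)
  also have "\<dots> = mu \<otimes> eta" by (simp add: merge mu_eta_eta)
  also have "\<dots> = (\<I> H \<otimes> eta) \<cdot> mu"
    using interchange[of mu "\<I> H" "\<I> \<K>" eta] by simp
  finally show ?thesis by simp
qed

lemma inr_mult: "(eta \<otimes> \<I> H) \<cdot> mu = mu2 \<cdot> ((eta \<otimes> \<I> H) \<otimes> (eta \<otimes> \<I> H))"
proof -
  have "mu2 \<cdot> ((eta \<otimes> \<I> H) \<otimes> (eta \<otimes> \<I> H)) = (mu \<otimes> mu) \<cdot> (eta \<otimes> eta \<otimes> \<I> H \<otimes> \<I> H)"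
    by (simp add: merge braiding_nat)
  also have "\<dots> = eta \<otimes> mu" by (simp add: merge mu_eta_eta)
  also have "\<dots> = (eta \<otimes> \<I> H) \<cdot> mu"
    using interchange[of "\<I> \<K>" eta mu "\<I> H"] by simp
  finally show ?thesis by simp
qed

lemma inl_inr: "mu2 \<cdot> ((\<I> H \<otimes> eta) \<otimes> (eta \<otimes> \<I> H)) = \<I> (H \<otimes>\<^sub>o H)"
proof -
  have "mu2 \<cdot> ((\<I> H \<otimes> eta) \<otimes> (eta \<otimes> \<I> H)) = (mu \<otimes> mu) \<cdot> (\<I> H \<otimes> eta \<otimes> eta \<otimes> \<I> H)"
    by (simp add: merge braiding_nat)
  then show ?thesis by (simp add: merge unit_laws)
qed

lemma inr_inl: "mu2 \<cdot> ((eta \<otimes> \<I> H) \<otimes> (\<I> H \<otimes> eta)) = \<c> H H"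
proof -
  have "eta \<otimes> \<c> H H \<otimes> eta = (eta \<otimes> \<I> H \<otimes> \<I> H \<otimes> eta) \<cdot> \<c> H H"
    using interchange[of "\<I> \<K>" eta "\<c> H H" "\<I> H \<otimes> \<I> H \<otimes> eta"]
      interchange[of "\<c> H H" "\<I> H \<otimes> \<I> H" "\<I> \<K>" eta] by (simp add: Tensor_assoc)
  then have "mu2 \<cdot> ((eta \<otimes> \<I> H) \<otimes> (\<I> H \<otimes> eta)) =
      (mu \<otimes> mu) \<cdot> ((eta \<otimes> \<I> H \<otimes> \<I> H \<otimes> eta) \<cdot> \<c> H H)"
    by (simp add: merge)
  then show ?thesis by (simp add: merge unit_laws)
qed

lemma lam_Comp_Hom: "f \<in> Hom X H \<Longrightarrow> lam \<cdot> f \<in> Hom X H"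
  by (simp add: Hom_iff)

lemma conv_in_Hom:
  "\<lbrakk>is_coalgebra C D; f \<in> Hom (carr D) H; g \<in> Hom (carr D) H\<rbrakk> \<Longrightarrow> conv D f g \<in> Hom (carr D) H"
  by (rule convolution_in_Hom[OF _ alg])

text \<open>Composition with the antipode inverts coalgebra morphisms for the convolution product.\<close>

lemma conv_antipode:
  assumes D: "is_coalgebra C D" and f: "coalgebra_mor C D A f"
  shows "conv D (lam \<cdot> f) f = eta \<cdot> \<epsilon>\<^bsub>D\<^esub>" "conv D f (lam \<cdot> f) = eta \<cdot> \<epsilon>\<^bsub>D\<^esub>"
proof -
  note [simp] = coalgebra_typing[OF D] coalgebra_mor_typing[OF f]
  have "eps \<cdot> f = \<epsilon>\<^bsub>D\<^esub>" using f by (simp add: coalgebra_mor_def)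
  then have *: "(eta \<cdot> eps) \<cdot> f = eta \<cdot> \<epsilon>\<^bsub>D\<^esub>" by (simp add: comp_assoc)
  have H: "lam \<in> Hom (carr A) H" "\<I> H \<in> Hom (carr A) H" by (simp_all add: Hom_iff)
  show "conv D (lam \<cdot> f) f = eta \<cdot> \<epsilon>\<^bsub>D\<^esub>" "conv D f (lam \<cdot> f) = eta \<cdot> \<epsilon>\<^bsub>D\<^esub>"
    using convolution_Comp[OF D coalg alg H f] convolution_Comp[OF D coalg alg H(2,1) f]
    by (simp_all add: lam_inverse *)
qed

lemma conv_inl_inr:
  assumes D: "is_coalgebra C D" and f: "f \<in> Hom (carr D) H" and g: "g \<in> Hom (carr D) H"
  shows "conv2 D ((\<I> H \<otimes> eta) \<cdot> f) ((eta \<otimes> \<I> H) \<cdot> g) = (f \<otimes> g) \<cdot> \<delta>\<^bsub>D\<^esub>"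
    and "conv2 D ((eta \<otimes> \<I> H) \<cdot> f) ((\<I> H \<otimes> eta) \<cdot> g) = \<c> H H \<cdot> ((f \<otimes> g) \<cdot> \<delta>\<^bsub>D\<^esub>)"
proof -
  note [simp] = coalgebra_typing[OF D] f[unfolded Hom_iff] g[unfolded Hom_iff]
  have a: "((\<I> H \<otimes> eta) \<cdot> f) \<otimes> ((eta \<otimes> \<I> H) \<cdot> g) = ((\<I> H \<otimes> eta) \<otimes> (eta \<otimes> \<I> H)) \<cdot> (f \<otimes> g)"
    "((eta \<otimes> \<I> H) \<cdot> f) \<otimes> ((\<I> H \<otimes> eta) \<cdot> g) = ((eta \<otimes> \<I> H) \<otimes> (\<I> H \<otimes> eta)) \<cdot> (f \<otimes> g)"
    by (simp_all add: interchange)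
  have "conv2 D ((\<I> H \<otimes> eta) \<cdot> f) ((eta \<otimes> \<I> H) \<cdot> g) =
      (mu2 \<cdot> ((\<I> H \<otimes> eta) \<otimes> (eta \<otimes> \<I> H))) \<cdot> ((f \<otimes> g) \<cdot> \<delta>\<^bsub>D\<^esub>)"
    unfolding convolution_def a by (simp add: comp_assoc)
  then show "conv2 D ((\<I> H \<otimes> eta) \<cdot> f) ((eta \<otimes> \<I> H) \<cdot> g) = (f \<otimes> g) \<cdot> \<delta>\<^bsub>D\<^esub>"
    unfolding inl_inr by simp
  have "conv2 D ((eta \<otimes> \<I> H) \<cdot> f) ((\<I> H \<otimes> eta) \<cdot> g) =
      (mu2 \<cdot> ((eta \<otimes> \<I> H) \<otimes> (\<I> H \<otimes> eta))) \<cdot> ((f \<otimes> g) \<cdot> \<delta>\<^bsub>D\<^esub>)"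
    unfolding convolution_def a by (simp add: comp_assoc)
  then show "conv2 D ((eta \<otimes> \<I> H) \<cdot> f) ((\<I> H \<otimes> eta) \<cdot> g) = \<c> H H \<cdot> ((f \<otimes> g) \<cdot> \<delta>\<^bsub>D\<^esub>)"
    unfolding inr_inl by simp
qed

context
  fixes D :: "('o, 'a, 'y) coalgebra_scheme"
  assumes D: "is_coalgebra C D"
begin

lemma inl_inr_in_Hom:
  assumes "f \<in> Hom (carr D) H"
  shows "inl f \<in> Hom (carr D) (H \<otimes>\<^sub>o H)" "inr f \<in> Hom (carr D) (H \<otimes>\<^sub>o H)"
  using assms by (simp_all add: Hom_iff)

lemma inl_inr_conv:
  assumes "f \<in> Hom (carr D) H" "g \<in> Hom (carr D) H"
  shows "inl (conv D f g) = conv2 D (inl f) (inl g)" "inr (conv D f g) = conv2 D (inr f) (inr g)"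
  by (rule Comp_convolution[OF D alg alg2 assms]; simp add: Hom_iff inl_mult inr_mult)+

lemma del_conv:
  assumes "f \<in> Hom (carr D) H" "g \<in> Hom (carr D) H"
  shows "del \<cdot> conv D f g = conv2 D (del \<cdot> f) (del \<cdot> g)"
  by (rule Comp_convolution[OF D alg alg2 assms]; simp add: Hom_iff counit_coprod_mu)

lemma eps_conv:
  assumes f: "f \<in> Hom (carr D) H" and g: "g \<in> Hom (carr D) H"
  shows "eps \<cdot> f = \<epsilon>\<^bsub>D\<^esub> \<Longrightarrow> eps \<cdot> conv D f g = eps \<cdot> g"
    and "eps \<cdot> g = \<epsilon>\<^bsub>D\<^esub> \<Longrightarrow> eps \<cdot> conv D f g = eps \<cdot> f"
proof -
  note [simp] = coalgebra_typing[OF D] f[unfolded Hom_iff] g[unfolded Hom_iff]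
  have e: "(\<epsilon>\<^bsub>D\<^esub> \<otimes> \<I> (carr D)) \<cdot> \<delta>\<^bsub>D\<^esub> = \<I> (carr D)" "(\<I> (carr D) \<otimes> \<epsilon>\<^bsub>D\<^esub>) \<cdot> \<delta>\<^bsub>D\<^esub> = \<I> (carr D)"
    using D by (simp_all add: is_coalgebra_def)
  have *: "eps \<cdot> conv D f g = ((eps \<cdot> f) \<otimes> (eps \<cdot> g)) \<cdot> \<delta>\<^bsub>D\<^esub>"
    by (simp add: convolution_def comp_left[OF counit_coprod_mu(1)] merge)
  show "eps \<cdot> conv D f g = eps \<cdot> g" if "eps \<cdot> f = \<epsilon>\<^bsub>D\<^esub>"
  proof -
    have "\<epsilon>\<^bsub>D\<^esub> \<otimes> (eps \<cdot> g) = (eps \<cdot> g) \<cdot> (\<epsilon>\<^bsub>D\<^esub> \<otimes> \<I> (carr D))"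
      using interchange[of "\<epsilon>\<^bsub>D\<^esub>" "\<I> \<K>" "\<I> (carr D)" "eps \<cdot> g"] by simp
    then show ?thesis by (simp add: * that comp_assoc e)
  qed
  show "eps \<cdot> conv D f g = eps \<cdot> f" if "eps \<cdot> g = \<epsilon>\<^bsub>D\<^esub>"
  proof -
    have "(eps \<cdot> f) \<otimes> \<epsilon>\<^bsub>D\<^esub> = (eps \<cdot> f) \<cdot> (\<I> (carr D) \<otimes> \<epsilon>\<^bsub>D\<^esub>)"
      using interchange[of "\<I> (carr D)" "eps \<cdot> f" "\<epsilon>\<^bsub>D\<^esub>" "\<I> \<K>"] by simp
    then show ?thesis by (simp add: * that comp_assoc e)
  qed
qed

lemma eps_antipode:
  assumes f: "coalgebra_mor C D A f"
  shows "eps \<cdot> (lam \<cdot> f) = \<epsilon>\<^bsub>D\<^esub>"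
proof -
  note [simp] = coalgebra_typing[OF D] coalgebra_mor_typing[OF f]
  have "eps \<cdot> f = \<epsilon>\<^bsub>D\<^esub>" using f by (simp add: coalgebra_mor_def)
  then have "eps \<cdot> (lam \<cdot> f) = eps \<cdot> conv D (lam \<cdot> f) f"
    by (subst eps_conv(2)) (simp_all add: Hom_iff)
  also have "\<dots> = \<epsilon>\<^bsub>D\<^esub>" by (simp add: conv_antipode[OF D f] comp_left[OF counit_coprod_eta(1)])
  finally show ?thesis .
qed

text \<open>Compatibility with coproducts as an equation in the convolution monoid of arrows into \<open>H \<otimes> H\<close>.\<close>

lemma coalgebra_mor_iff_conv:
  "coalgebra_mor C D A f \<longleftrightarrow>
    f \<in> Hom (carr D) H \<and> eps \<cdot> f = \<epsilon>\<^bsub>D\<^esub> \<and> del \<cdot> f = conv2 D (inl f) (inr f)"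
  using conv_inl_inr(1)[OF D, of f f] by (auto simp: coalgebra_mor_def)

text \<open>The antipode reverses coproducts: inverting \<open>inl f * inr f\<close>, the inverses come in opposite order.\<close>

lemma del_antipode:
  assumes f: "coalgebra_mor C D A f"
  shows "del \<cdot> (lam \<cdot> f) = conv2 D (inr (lam \<cdot> f)) (inl (lam \<cdot> f))"
proof -
  note [simp] = coalgebra_typing[OF D] coalgebra_mor_typing[OF f]
  have fH: "f \<in> Hom (carr D) H" "lam \<cdot> f \<in> Hom (carr D) H" by (simp_all add: Hom_iff)
  have one: "eta \<cdot> \<epsilon>\<^bsub>D\<^esub> \<in> Hom (carr D) H" by (simp add: Hom_iff)
  have units: "del \<cdot> (eta \<cdot> \<epsilon>\<^bsub>D\<^esub>) = (eta \<otimes> eta) \<cdot> \<epsilon>\<^bsub>D\<^esub>"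
    "inl (eta \<cdot> \<epsilon>\<^bsub>D\<^esub>) = (eta \<otimes> eta) \<cdot> \<epsilon>\<^bsub>D\<^esub>" "inr (eta \<cdot> \<epsilon>\<^bsub>D\<^esub>) = (eta \<otimes> eta) \<cdot> \<epsilon>\<^bsub>D\<^esub>"
    using interchange[of eta "\<I> H" "\<I> \<K>" eta] interchange[of "\<I> \<K>" eta eta "\<I> H"]
    by (simp_all add: comp_left[OF counit_coprod_eta(2)] comp_left[where h = "eta \<otimes> eta"])
  note h = inl_inr_in_Hom[OF fH(1)] inl_inr_in_Hom[OF fH(2)]
  note assoc = convolution_assoc[OF D alg2] and unit = convolution_unit[OF D alg2]
    and hom2 = convolution_in_Hom[OF D alg2]
  show ?thesis
  proof (rule convolution_inverse_unique[OF D alg2, where g = "del \<cdot> f"])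
    show "conv2 D (del \<cdot> (lam \<cdot> f)) (del \<cdot> f) = (eta \<otimes> eta) \<cdot> \<epsilon>\<^bsub>D\<^esub>"
      using del_conv[OF fH(2,1)] by (simp add: conv_antipode[OF D f] units)
    have "conv2 D (del \<cdot> f) (conv2 D (inr (lam \<cdot> f)) (inl (lam \<cdot> f))) =
        conv2 D (inl f) (conv2 D (conv2 D (inr f) (inr (lam \<cdot> f))) (inl (lam \<cdot> f)))"
      using f h by (simp add: coalgebra_mor_iff_conv assoc hom2)
    also have "conv2 D (inr f) (inr (lam \<cdot> f)) = (eta \<otimes> eta) \<cdot> \<epsilon>\<^bsub>D\<^esub>"
      using inl_inr_conv(2)[OF fH] by (simp add: conv_antipode[OF D f] units)
    also have "conv2 D (inl f) (conv2 D ((eta \<otimes> eta) \<cdot> \<epsilon>\<^bsub>D\<^esub>) (inl (lam \<cdot> f))) = (eta \<otimes> eta) \<cdot> \<epsilon>\<^bsub>D\<^esub>"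
      unfolding unit(1)[OF h(3)] inl_inr_conv(1)[OF fH, symmetric] conv_antipode[OF D f] units ..
    finally show "conv2 D (del \<cdot> f) (conv2 D (inr (lam \<cdot> f)) (inl (lam \<cdot> f))) = (eta \<otimes> eta) \<cdot> \<epsilon>\<^bsub>D\<^esub>" .
  qed (use h in \<open>simp_all add: Hom_iff hom2[unfolded Hom_iff]\<close>)
qed

text \<open>The convolution of two coalgebra morphisms is a coalgebra morphism if \<open>inr f\<close> and \<open>inl g\<close> commute,
since then \<open>inl f * inr f * inl g * inr g\<close> equals \<open>inl f * inl g * inr f * inr g\<close>. The
hypothesis below expresses this commutation.\<close>

lemma coalgebra_mor_conv:
  assumes f: "coalgebra_mor C D A f" and g: "coalgebra_mor C D A g"
    and comm: "\<c> H H \<cdot> ((f \<otimes> g) \<cdot> \<delta>\<^bsub>D\<^esub>) = (g \<otimes> f) \<cdot> \<delta>\<^bsub>D\<^esub>"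
  shows "coalgebra_mor C D A (conv D f g)"
proof -
  note fH = coalgebra_mor_Hom[OF f] and gH = coalgebra_mor_Hom[OF g]
  note h = inl_inr_in_Hom[OF fH] inl_inr_in_Hom[OF gH]
  note assoc = convolution_assoc[OF D alg2] and hom2 = convolution_in_Hom[OF D alg2]
  have swap: "conv2 D (inr f) (inl g) = conv2 D (inl g) (inr f)"
    using conv_inl_inr[OF D] fH gH comm by simp
  have "del \<cdot> conv D f g = conv2 D (inl f) (conv2 D (conv2 D (inr f) (inl g)) (inr g))"
    using f g h by (simp add: del_conv coalgebra_mor_iff_conv assoc hom2)
  also have "\<dots> = conv2 D (inl (conv D f g)) (inr (conv D f g))"
    using fH gH h by (simp add: swap inl_inr_conv assoc hom2)
  finally show ?thesis
    using f g by (simp add: coalgebra_mor_iff_conv conv_in_Hom[OF D] eps_conv)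
qed

text \<open>The same for the quotient \<open>t = (lam \<cdot> f) * g\<close>. Its coproduct is
\<open>inr (lam \<cdot> f) * inl (lam \<cdot> f) * inl g * inr g = inr (lam \<cdot> f) * inl t * inr g\<close>, so that it is \<open>inl t\<close>
that has to commute with \<open>inr (lam \<cdot> f)\<close>.\<close>

lemma coalgebra_mor_antipode_conv:
  assumes f: "coalgebra_mor C D A f" and g: "coalgebra_mor C D A g"
    and comm: "\<c> H H \<cdot> ((f \<otimes> conv D (lam \<cdot> f) g) \<cdot> \<delta>\<^bsub>D\<^esub>) = (conv D (lam \<cdot> f) g \<otimes> f) \<cdot> \<delta>\<^bsub>D\<^esub>"
  shows "coalgebra_mor C D A (conv D (lam \<cdot> f) g)"
proof -
  let ?t = "conv D (lam \<cdot> f) g"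
  note fH = coalgebra_mor_Hom[OF f] and gH = coalgebra_mor_Hom[OF g]
  note lH = lam_Comp_Hom[OF fH]
  have tH: "?t \<in> Hom (carr D) H" by (rule conv_in_Hom[OF D lH gH])
  note [simp] = coalgebra_typing[OF D] fH[unfolded Hom_iff] gH[unfolded Hom_iff] tH[unfolded Hom_iff]
  have "\<c> H H \<cdot> (((lam \<cdot> f) \<otimes> ?t) \<cdot> \<delta>\<^bsub>D\<^esub>) = \<c> H H \<cdot> ((lam \<otimes> \<I> H) \<cdot> ((f \<otimes> ?t) \<cdot> \<delta>\<^bsub>D\<^esub>))"
    by (simp add: merge)
  also have "\<dots> = (\<I> H \<otimes> lam) \<cdot> (\<c> H H \<cdot> ((f \<otimes> ?t) \<cdot> \<delta>\<^bsub>D\<^esub>))"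
    by (simp add: comp_left[OF braiding_nat] comp_assoc)
  also have "\<dots> = (?t \<otimes> (lam \<cdot> f)) \<cdot> \<delta>\<^bsub>D\<^esub>"
    unfolding comm by (simp add: merge)
  finally have comm': "conv2 D (inr (lam \<cdot> f)) (inl ?t) = conv2 D (inl ?t) (inr (lam \<cdot> f))"
    using conv_inl_inr[OF D] lH tH by simp
  note h = inl_inr_in_Hom[OF fH] inl_inr_in_Hom[OF gH] inl_inr_in_Hom[OF lH] inl_inr_in_Hom[OF tH]
  note assoc = convolution_assoc[OF D alg2] and hom2 = convolution_in_Hom[OF D alg2]
  have "del \<cdot> ?t = conv2 D (inr (lam \<cdot> f)) (conv2 D (conv2 D (inl (lam \<cdot> f)) (inl g)) (inr g))"
    using f g h lH by (simp add: del_conv del_antipode coalgebra_mor_iff_conv assoc hom2)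
  also have "\<dots> = conv2 D (conv2 D (inr (lam \<cdot> f)) (inl ?t)) (inr g)"
    unfolding inl_inr_conv(1)[OF lH gH, symmetric] using h by (simp add: assoc)
  also have "\<dots> = conv2 D (inl ?t) (conv2 D (inr (lam \<cdot> f)) (inr g))"
    unfolding comm' using h by (simp add: assoc)
  also have "\<dots> = conv2 D (inl ?t) (inr ?t)"
    unfolding inl_inr_conv(2)[OF lH gH] ..
  finally show ?thesis
    using f g lH by (simp add: coalgebra_mor_iff_conv conv_in_Hom[OF D] eps_conv eps_antipode)
qed

end

section \<open>Arrows of two and three variables\<close>

text \<open>The projection of \<open>H \<otimes> H\<close> onto its first factor, a coalgebra morphism.\<close>

abbreviation "q \<equiv> \<I> H \<otimes> eps"

abbreviation "HHH \<equiv> tensor_coalgebra C A HH"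

lemma coalg_HHH: "is_coalgebra C HHH"
  by (rule tensor_is_coalgebra[OF coalg coalg_HH])

lemma HHH_assoc: "tensor_coalgebra C HH A = HHH"
  by (rule tensor_coalgebra_assoc[OF coalg coalg coalg])

lemma q_coprod:
  assumes t: "t \<in> Hom (H \<otimes>\<^sub>o H) H"
  shows "(q \<otimes> t) \<cdot> coprod HH = (\<I> H \<otimes> t) \<cdot> (del \<otimes> \<I> H)"
    and "(t \<otimes> q) \<cdot> coprod HH = (t \<otimes> \<I> H) \<cdot> ((\<I> H \<otimes> \<c> H H) \<cdot> (del \<otimes> \<I> H))"
proof -
  note [simp] = t[unfolded Hom_iff]
  have "(\<I> H \<otimes> eps \<otimes> \<I> H \<otimes> \<I> H) \<cdot> coprod HH = del \<otimes> \<I> H"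
    by (simp add: tensor_coprod merge braiding_nat_rev counit_laws)
  moreover have "q \<otimes> t = (\<I> H \<otimes> t) \<cdot> (\<I> H \<otimes> eps \<otimes> \<I> H \<otimes> \<I> H)"
    using interchange[of eps "\<I> \<K>" "\<I> (H \<otimes>\<^sub>o H)" t]
    by (simp add: Tensor_assoc interchange Ident_Tensor)
  ultimately show "(q \<otimes> t) \<cdot> coprod HH = (\<I> H \<otimes> t) \<cdot> (del \<otimes> \<I> H)"
    using coalgebra_typing[OF coalg_HH] by (simp add: comp_assoc)
  have "(\<I> H \<otimes> \<I> H \<otimes> \<I> H \<otimes> eps) \<cdot> coprod HH = (\<I> H \<otimes> \<c> H H) \<cdot> (del \<otimes> \<I> H)"
  proof -
    have "(\<I> H \<otimes> \<I> H \<otimes> \<I> H \<otimes> eps) \<cdot> (\<I> H \<otimes> \<c> H H \<otimes> \<I> H) = (\<I> H \<otimes> \<c> H H) \<cdot> (\<I> H \<otimes> \<I> H \<otimes> \<I> H \<otimes> eps)"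
      using interchange[of "\<I> (H \<otimes>\<^sub>o H)" "\<c> H H" eps "\<I> \<K>"]
      by (simp add: interchange interchange21 Ident_Tensor Tensor_assoc)
    moreover have "(\<I> H \<otimes> \<I> H \<otimes> \<I> H \<otimes> eps) \<cdot> (del \<otimes> del) = del \<otimes> \<I> H"
      by (simp add: merge counit_laws)
    ultimately show ?thesis
      by (simp add: tensor_coprod comp_left comp_assoc)
  qed
  moreover have "t \<otimes> q = (t \<otimes> \<I> H) \<cdot> (\<I> H \<otimes> \<I> H \<otimes> \<I> H \<otimes> eps)"
    by (simp add: interchange21 interchange12)
  ultimately show "(t \<otimes> q) \<cdot> coprod HH = (t \<otimes> \<I> H) \<cdot> ((\<I> H \<otimes> \<c> H H) \<cdot> (del \<otimes> \<I> H))"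
    using coalgebra_typing[OF coalg_HH] by (simp add: comp_assoc)
qed

lemma conv_q:
  assumes f: "f \<in> Hom H H" and t: "t \<in> Hom (H \<otimes>\<^sub>o H) H"
  shows "conv HH (f \<cdot> q) t = mu \<cdot> ((f \<otimes> t) \<cdot> (del \<otimes> \<I> H))"
proof -
  note [simp] = t[unfolded Hom_iff] f[unfolded Hom_iff] coalgebra_typing[OF coalg_HH]
  have "(f \<cdot> q) \<otimes> t = (f \<otimes> \<I> H) \<cdot> (q \<otimes> t)" by (simp add: interchange)
  then have "conv HH (f \<cdot> q) t = mu \<cdot> ((f \<otimes> \<I> H) \<cdot> ((\<I> H \<otimes> t) \<cdot> (del \<otimes> \<I> H)))"
    by (simp add: convolution_def comp_assoc flip: q_coprod(1)[OF t])
  also have "\<dots> = mu \<cdot> ((f \<otimes> t) \<cdot> (del \<otimes> \<I> H))"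
    by (simp add: merge)
  finally show ?thesis .
qed

lemma q_coalgebra_mor: "coalgebra_mor C HH A q"
proof -
  have "coalgebra_mor C HH (tensor_coalgebra C A (unit_coalgebra C)) q"
    by (rule coalgebra_mor_Tensor[OF coalg coalg coalg unit_is_coalgebra coalgebra_mor_Ident[OF coalg]
      coalgebra_mor_counit[OF coalg]])
  then show ?thesis by (simp add: coalgebra_mor_def tensor_unit_coalgebra[OF coalg])
qed

text \<open>By the hexagon and naturality, the left-hand side of the star condition is
\<open>\<c> H H \<cdot> (\<I> H \<otimes> t) \<cdot> (\<delta> \<otimes> \<I> H)\<close>. The condition therefore says that \<open>inr q\<close> and \<open>inl t\<close> commute
for convolution, and the same follows for \<open>f \<cdot> q\<close> in place of \<open>q\<close>.\<close>

lemma star_condition_commute: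
  assumes t: "t \<in> Hom (H \<otimes>\<^sub>o H) H" and f: "f \<in> Hom H H" and star: "star_condition C A t"
  shows "\<c> H H \<cdot> (((f \<cdot> q) \<otimes> t) \<cdot> coprod HH) = (t \<otimes> (f \<cdot> q)) \<cdot> coprod HH"
proof -
  note [simp] = t[unfolded Hom_iff] f[unfolded Hom_iff] coalgebra_typing[OF coalg_HH]
  have "\<c> H H \<cdot> ((q \<otimes> t) \<cdot> coprod HH) = (t \<otimes> \<I> H) \<cdot> (\<c> H (H \<otimes>\<^sub>o H) \<cdot> (del \<otimes> \<I> H))"
    by (simp add: q_coprod[OF t] comp_left[OF braiding_nat] comp_assoc)
  also have "\<dots> = (t \<otimes> \<I> H) \<cdot> (\<I> H \<otimes> \<c> H H) \<cdot> ((\<c> H H \<cdot> del) \<otimes> \<I> H)"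
    by (simp add: hexagon_right slices)
  also have "\<dots> = (t \<otimes> q) \<cdot> coprod HH"
    using star by (simp add: star_condition_def q_coprod[OF t] Let_def comp_assoc)
  finally have *: "\<c> H H \<cdot> ((q \<otimes> t) \<cdot> coprod HH) = (t \<otimes> q) \<cdot> coprod HH" .
  have "\<c> H H \<cdot> (((f \<cdot> q) \<otimes> t) \<cdot> coprod HH) = \<c> H H \<cdot> ((f \<otimes> \<I> H) \<cdot> ((q \<otimes> t) \<cdot> coprod HH))"
    by (simp add: interchange_left)
  also have "\<dots> = (\<I> H \<otimes> f) \<cdot> (\<c> H H \<cdot> ((q \<otimes> t) \<cdot> coprod HH))"
    by (simp add: comp_left[OF braiding_nat] comp_assoc)
  also have "\<dots> = (t \<otimes> (f \<cdot> q)) \<cdot> coprod HH"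
    unfolding * by (simp add: interchange_left)
  finally show ?thesis .
qed

text \<open>The common form of the distributive law of post-Hopf algebras, with \<open>t = u = v = m\<close>, and of that of
trusses, with \<open>t\<close> and \<open>u\<close> the second product and \<open>v\<close> the arrow \<open>\<Gamma>\<close>.\<close>

definition distributes :: "'a \<Rightarrow> 'a \<Rightarrow> 'a \<Rightarrow> bool" where
  "distributes t u v \<longleftrightarrow> t \<cdot> (\<I> H \<otimes> mu) =
      mu \<cdot> (u \<otimes> v) \<cdot> (\<I> H \<otimes> \<c> H H \<otimes> \<I> H) \<cdot> (del \<otimes> \<I> H \<otimes> \<I> H)"

lemma tensor_conv:
  assumes D: "is_coalgebra C D" and a: "a \<in> Hom (carr D) H" and b: "b \<in> Hom (carr D) H"
    and u: "u \<in> Hom (H \<otimes>\<^sub>o H) H" and v: "v \<in> Hom (H \<otimes>\<^sub>o H) H"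
  shows "conv (tensor_coalgebra C A D) (u \<cdot> (\<I> H \<otimes> a)) (v \<cdot> (\<I> H \<otimes> b)) =
    mu \<cdot> (u \<otimes> v) \<cdot> (\<I> H \<otimes> \<c> H H \<otimes> \<I> H) \<cdot> (del \<otimes> \<I> H \<otimes> \<I> H) \<cdot> (\<I> H \<otimes> ((a \<otimes> b) \<cdot> \<delta>\<^bsub>D\<^esub>))"
proof -
  let ?X = "carr D"
  note [simp] = coalgebra_typing[OF D] a[unfolded Hom_iff] b[unfolded Hom_iff] u[unfolded Hom_iff] v[unfolded Hom_iff]
  have 1: "(u \<cdot> (\<I> H \<otimes> a)) \<otimes> (v \<cdot> (\<I> H \<otimes> b)) = (u \<otimes> v) \<cdot> (\<I> H \<otimes> a \<otimes> \<I> H \<otimes> b)"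
    by (simp add: Tensor_assoc flip: interchange)
  have 2: "(\<I> H \<otimes> a \<otimes> \<I> H \<otimes> b) \<cdot> (\<I> H \<otimes> \<c> H ?X \<otimes> \<I> ?X) = (\<I> H \<otimes> \<c> H H \<otimes> \<I> H) \<cdot> (\<I> H \<otimes> \<I> H \<otimes> a \<otimes> b)"
    by (simp add: merge braiding_nat)
  have 3: "(\<I> H \<otimes> \<I> H \<otimes> a \<otimes> b) \<cdot> (del \<otimes> \<delta>\<^bsub>D\<^esub>) = (del \<otimes> \<I> H \<otimes> \<I> H) \<cdot> (\<I> H \<otimes> ((a \<otimes> b) \<cdot> \<delta>\<^bsub>D\<^esub>))"
    by (simp add: merge)
  show ?thesis
    unfolding convolution_def 1 tensor_coprod by (simp add: comp_assoc comp_left[OF 2] 3)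
qed

text \<open>The distributive law applied to a convolution product in the second variable. No condition on the
arrows \<open>a\<close> and \<open>b\<close> is needed.\<close>

lemma distributes_conv:
  assumes D: "is_coalgebra C D" and a: "a \<in> Hom (carr D) H" and b: "b \<in> Hom (carr D) H"
    and t: "t \<in> Hom (H \<otimes>\<^sub>o H) H" and u: "u \<in> Hom (H \<otimes>\<^sub>o H) H" and v: "v \<in> Hom (H \<otimes>\<^sub>o H) H"
    and "distributes t u v"
  shows "t \<cdot> (\<I> H \<otimes> conv D a b) =
    conv (tensor_coalgebra C A D) (u \<cdot> (\<I> H \<otimes> a)) (v \<cdot> (\<I> H \<otimes> b))"
proof -
  note [simp] = coalgebra_typing[OF D] a[unfolded Hom_iff] b[unfolded Hom_iff]
    t[unfolded Hom_iff] u[unfolded Hom_iff] v[unfolded Hom_iff]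
  have "t \<cdot> (\<I> H \<otimes> conv D a b) = (t \<cdot> (\<I> H \<otimes> mu)) \<cdot> (\<I> H \<otimes> ((a \<otimes> b) \<cdot> \<delta>\<^bsub>D\<^esub>))"
    by (simp add: convolution_def merge)
  also have "\<dots> = conv (tensor_coalgebra C A D) (u \<cdot> (\<I> H \<otimes> a)) (v \<cdot> (\<I> H \<otimes> b))"
    unfolding assms(7)[unfolded distributes_def] tensor_conv[OF D a b u v] by (simp add: comp_assoc)
  finally show ?thesis .
qed

lemma eps_H_coalgebra_mor: "coalgebra_mor C HH A (eps \<otimes> \<I> H)"
proof -
  have t: "tensor_coalgebra C (unit_coalgebra C) A = \<lparr>carr = H, counit = eps, coprod = del\<rparr>"
    by (simp add: tensor_coalgebra_def Tensor_Ident)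
  have "coalgebra_mor C HH (tensor_coalgebra C (unit_coalgebra C) A) (eps \<otimes> \<I> H)"
    by (rule coalgebra_mor_Tensor[OF coalg coalg unit_is_coalgebra coalg
      coalgebra_mor_counit[OF coalg] coalgebra_mor_Ident[OF coalg]])
  then show ?thesis by (simp add: coalgebra_mor_def t)
qed

lemma q_eps_coprod: "(q \<otimes> (eps \<otimes> \<I> H)) \<cdot> coprod HH = \<I> (H \<otimes>\<^sub>o H)"
  using q_coprod(1)[of "eps \<otimes> \<I> H"]
  by (simp add: Hom_iff interchange12 interchange counit_laws Ident_Tensor flip: Tensor_assoc)

text \<open>The product of \<open>H\<close> is itself the convolution of the two projections of \<open>H \<otimes> H\<close>.\<close>

lemma distributes_iff:
  assumes t: "t \<in> Hom (H \<otimes>\<^sub>o H) H" and u: "u \<in> Hom (H \<otimes>\<^sub>o H) H" and v: "v \<in> Hom (H \<otimes>\<^sub>o H) H"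
  shows "distributes t u v \<longleftrightarrow>
     t \<cdot> (\<I> H \<otimes> mu) = conv HHH (u \<cdot> (\<I> H \<otimes> q)) (v \<cdot> (\<I> H \<otimes> eps \<otimes> \<I> H))"
  using tensor_conv[OF coalg_HH _ _ u v, of q "eps \<otimes> \<I> H"] u v
  by (simp add: distributes_def q_eps_coprod Hom_iff)

section \<open>Post-Hopf algebras and trusses on a fixed Hopf algebra\<close>

text \<open>The two passages: \<open>circ \<Phi> m\<close> is the second product of the truss of a post-Hopf algebra
\<open>(m, \<Phi>)\<close>, and \<open>gam \<sigma> M\<close> is the arrow \<open>\<Gamma>\<close> of a truss with second product \<open>M\<close>. They are
convolution by \<open>f \<cdot> q\<close> and by its inverse.\<close>

abbreviation "circ f t \<equiv> conv HH (f \<cdot> q) t"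
abbreviation "gam f t \<equiv> conv HH (lam \<cdot> (f \<cdot> q)) t"

text \<open>The structure of a weak twisted post-Hopf algebra on the given Hopf algebra.\<close>

definition post_hopf :: "'a \<Rightarrow> 'a \<Rightarrow> bool" where
  "post_hopf m \<Phi> \<longleftrightarrow> coalgebra_mor C HH A m \<and> coalgebra_mor C A A \<Phi> \<and>
    \<Phi> \<cdot> circ \<Phi> m = circ \<Phi> m \<cdot> (\<I> H \<otimes> \<Phi>) \<and>
    m \<cdot> (\<I> H \<otimes> m) = m \<cdot> (circ \<Phi> m \<otimes> \<I> H) \<and> distributes m m m"

text \<open>The structure of a Hopf truss on the given Hopf algebra, with second product \<open>M\<close> and cocycle \<open>\<sigma>\<close>.\<close>

definition truss :: "'a \<Rightarrow> 'a \<Rightarrow> bool" where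
  "truss M \<sigma> \<longleftrightarrow> coalgebra_mor C HH A M \<and> coalgebra_mor C A A \<sigma> \<and>
    M \<cdot> (M \<otimes> \<I> H) = M \<cdot> (\<I> H \<otimes> M) \<and> distributes M M (gam \<sigma> M)"

lemma whisker_coalgebra_mor:
  assumes "coalgebra_mor C HH A x"
  shows "coalgebra_mor C HHH HH (\<I> H \<otimes> x)" "coalgebra_mor C HHH HH (x \<otimes> \<I> H)"
  using coalgebra_mor_Tensor[OF coalg coalg_HH coalg coalg coalgebra_mor_Ident[OF coalg] assms]
    coalgebra_mor_Tensor[OF coalg_HH coalg coalg coalg assms coalgebra_mor_Ident[OF coalg]]
  by (simp_all add: HHH_assoc)

lemma q_Comp:
  assumes x: "x \<in> Hom (H \<otimes>\<^sub>o H) H"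
  shows "eps \<cdot> x = eps \<otimes> eps \<Longrightarrow> q \<cdot> (\<I> H \<otimes> x) = \<I> H \<otimes> eps \<otimes> eps"
    and "q \<cdot> (x \<otimes> \<I> H) = x \<cdot> (\<I> H \<otimes> q)"
proof -
  note [simp] = x[unfolded Hom_iff]
  show "eps \<cdot> x = eps \<otimes> eps \<Longrightarrow> q \<cdot> (\<I> H \<otimes> x) = \<I> H \<otimes> eps \<otimes> eps"
    by (simp add: interchange)
  have "q \<cdot> (x \<otimes> \<I> H) = x \<otimes> eps" by (simp add: interchange)
  also have "\<dots> = x \<cdot> (\<I> H \<otimes> q)"
    using interchange[of "\<I> (H \<otimes>\<^sub>o H)" x eps "\<I> \<K>"] by (simp add: Ident_Tensor Tensor_assoc)
  finally show "q \<cdot> (x \<otimes> \<I> H) = x \<cdot> (\<I> H \<otimes> q)" .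
qed

lemma eps_q: "eps \<cdot> q = eps \<otimes> eps"
  using q_coalgebra_mor by (simp add: coalgebra_mor_def)

lemma conv_whisker:
  assumes f: "f \<in> Hom (H \<otimes>\<^sub>o H) H" and g: "g \<in> Hom (H \<otimes>\<^sub>o H) H" and x: "coalgebra_mor C HH A x"
  shows "conv HH f g \<cdot> (\<I> H \<otimes> x) = conv HHH (f \<cdot> (\<I> H \<otimes> x)) (g \<cdot> (\<I> H \<otimes> x))"
    and "conv HH f g \<cdot> (x \<otimes> \<I> H) = conv HHH (f \<cdot> (x \<otimes> \<I> H)) (g \<cdot> (x \<otimes> \<I> H))"
  using f g by (auto intro!: convolution_Comp[OF coalg_HHH coalg_HH alg _ _ whisker_coalgebra_mor(1)[OF x]]
      convolution_Comp[OF coalg_HHH coalg_HH alg _ _ whisker_coalgebra_mor(2)[OF x]])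

lemma distributes_circ:
  assumes f: "f \<in> Hom H H" and t: "t \<in> Hom (H \<otimes>\<^sub>o H) H" and v: "v \<in> Hom (H \<otimes>\<^sub>o H) H"
    and dist: "distributes t t v"
  shows "distributes (circ f t) (circ f t) v"
proof -
  have fq: "f \<cdot> q \<in> Hom (H \<otimes>\<^sub>o H) H" using f by (simp add: Hom_iff)
  note circ = conv_in_Hom[OF coalg_HH, simplified, OF fq t]
  have same: "(f \<cdot> q) \<cdot> (\<I> H \<otimes> mu) = (f \<cdot> q) \<cdot> (\<I> H \<otimes> q)"
    using f by (simp add: comp_assoc q_Comp(1) Hom_iff counit_coprod_mu eps_q)
  have homs: "(f \<cdot> q) \<cdot> (\<I> H \<otimes> q) \<in> Hom (carr HHH) H" "t \<cdot> (\<I> H \<otimes> q) \<in> Hom (carr HHH) H"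
    "v \<cdot> (\<I> H \<otimes> eps \<otimes> \<I> H) \<in> Hom (carr HHH) H"
    using f t v by (simp_all add: Hom_iff)
  have "circ f t \<cdot> (\<I> H \<otimes> mu) =
      conv HHH ((f \<cdot> q) \<cdot> (\<I> H \<otimes> q)) (conv HHH (t \<cdot> (\<I> H \<otimes> q)) (v \<cdot> (\<I> H \<otimes> eps \<otimes> \<I> H)))"
    using dist unfolding conv_whisker(1)[OF fq t mu_coalgebra_mor] same distributes_iff[OF t t v] by simp
  also have "\<dots> = conv HHH (circ f t \<cdot> (\<I> H \<otimes> q)) (v \<cdot> (\<I> H \<otimes> eps \<otimes> \<I> H))"
    unfolding conv_whisker(1)[OF fq t q_coalgebra_mor]
    by (rule convolution_assoc[OF coalg_HHH alg homs, symmetric])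
  finally show ?thesis unfolding distributes_iff[OF circ circ v] .
qed

lemma gam_circ:
  assumes f: "coalgebra_mor C A A f" and t: "t \<in> Hom (H \<otimes>\<^sub>o H) H"
  shows "gam f (circ f t) = t" "circ f (gam f t) = t"
proof -
  have fq: "coalgebra_mor C HH A (f \<cdot> q)"
    by (rule coalgebra_mor_Comp[OF coalg_HH coalg coalg q_coalgebra_mor f])
  note h = coalgebra_mor_Hom[OF fq]
  have t': "t \<in> Hom (carr HH) H" using t by simp
  note a = convolution_assoc[OF coalg_HH alg _ _ t']
  show "gam f (circ f t) = t" "circ f (gam f t) = t"
    using a[OF h lam_Comp_Hom[OF h]] a[OF lam_Comp_Hom[OF h] h]
    by (simp_all add: conv_antipode[OF coalg_HH fq] convolution_unit[OF coalg_HH alg t', simplified])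
qed

text \<open>The star condition is used only to see that the second product is a coalgebra morphism.\<close>

lemma truss_of_post_hopf:
  assumes "post_hopf m \<Phi>" and star: "star_condition C A m"
  shows "truss (circ \<Phi> m) \<Phi>"
proof -
  let ?M = "circ \<Phi> m"
  have m: "coalgebra_mor C HH A m" and \<Phi>: "coalgebra_mor C A A \<Phi>"
    and i: "\<Phi> \<cdot> ?M = ?M \<cdot> (\<I> H \<otimes> \<Phi>)" and ii: "m \<cdot> (\<I> H \<otimes> m) = m \<cdot> (?M \<otimes> \<I> H)"
    and iii: "distributes m m m"
    using assms(1) by (auto simp: post_hopf_def)
  have \<Phi>q: "coalgebra_mor C HH A (\<Phi> \<cdot> q)"
    by (rule coalgebra_mor_Comp[OF coalg_HH coalg coalg q_coalgebra_mor \<Phi>])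
  note mH = coalgebra_mor_Hom[OF m, simplified] and \<Phi>H = coalgebra_mor_Hom[OF \<Phi>]
    and \<Phi>qH = coalgebra_mor_Hom[OF \<Phi>q, simplified]
  have M: "coalgebra_mor C HH A ?M"
    by (rule coalgebra_mor_conv[OF coalg_HH \<Phi>q m star_condition_commute[OF mH \<Phi>H star]])
  note MH = coalgebra_mor_Hom[OF M, simplified]
  have dist: "distributes ?M ?M m"
    by (rule distributes_circ[OF \<Phi>H mH mH iii])
  note [simp] = mH[unfolded Hom_iff] \<Phi>H[unfolded Hom_iff] MH[unfolded Hom_iff]
  have "(\<Phi> \<cdot> q) \<cdot> (?M \<otimes> \<I> H) = (\<Phi> \<cdot> ?M) \<cdot> (\<I> H \<otimes> q)"
    by (simp add: comp_assoc q_Comp(2)[OF MH])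
  also have "\<dots> = ?M \<cdot> (\<I> H \<otimes> (\<Phi> \<cdot> q))"
    unfolding i by (simp add: comp_assoc interchange)
  finally have "?M \<cdot> (?M \<otimes> \<I> H) = conv HHH (?M \<cdot> (\<I> H \<otimes> (\<Phi> \<cdot> q))) (m \<cdot> (\<I> H \<otimes> m))"
    unfolding conv_whisker(2)[OF \<Phi>qH mH M] ii by simp
  also have "\<dots> = ?M \<cdot> (\<I> H \<otimes> ?M)"
    using distributes_conv[OF coalg_HH _ _ MH MH mH dist] \<Phi>qH mH by simp
  finally show ?thesis
    using M \<Phi> dist by (simp add: truss_def gam_circ[OF \<Phi> mH])
qed

text \<open>The cocycle of a truss is determined by the two products, \<open>\<sigma> = M \<cdot> (\<I> H \<otimes> \<eta>)\<close>. Write \<open>w\<close> for the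
right-hand side, a coalgebra morphism. The distributive law at the units reads
\<open>w = w * ((lam \<cdot> \<sigma>) * w)\<close>; cancelling \<open>w\<close> shows that \<open>w\<close> is the convolution inverse of \<open>lam \<cdot> \<sigma>\<close>,
which is \<open>\<sigma>\<close>.\<close>

lemma truss_cocycle:
  assumes "truss M \<sigma>"
  shows "M \<cdot> (\<I> H \<otimes> eta) = \<sigma>"
proof -
  let ?G = "gam \<sigma> M" and ?w = "M \<cdot> (\<I> H \<otimes> eta)" and ?AK = "tensor_coalgebra C A (unit_coalgebra C)"
  have M: "coalgebra_mor C HH A M" and \<sigma>: "coalgebra_mor C A A \<sigma>"
    and dist: "distributes M M ?G"
    using assms by (auto simp: truss_def)
  note MH = coalgebra_mor_Hom[OF M, simplified] and \<sigma>H = coalgebra_mor_Hom[OF \<sigma>]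
  note [simp] = MH[unfolded Hom_iff] \<sigma>H[unfolded Hom_iff]
  have lH: "lam \<cdot> (\<sigma> \<cdot> q) \<in> Hom (H \<otimes>\<^sub>o H) H" by (simp add: Hom_iff)
  note GH = conv_in_Hom[OF coalg_HH, simplified, OF lH MH]
  \<comment> \<open>Up to the identification of \<open>H \<otimes> K\<close> with \<open>H\<close>, convolution over \<open>?AK\<close> is convolution over \<open>A\<close>.\<close>
  have AK: "is_coalgebra C ?AK" by (rule tensor_is_coalgebra[OF coalg unit_is_coalgebra])
  have AKconv: "convolution C ?AK \<mu>' f g = convolution C A \<mu>' f g" for \<mu>' f g
    by (simp add: convolution_def tensor_unit_coalgebra[OF coalg])
  have AKmor: "coalgebra_mor C ?AK E f = coalgebra_mor C A E f" for E :: "('o, 'a, 'x) coalgebra_scheme" and f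
    by (simp add: coalgebra_mor_def tensor_unit_coalgebra[OF coalg])
  have \<eta>: "coalgebra_mor C ?AK HH (\<I> H \<otimes> eta)"
    by (rule coalgebra_mor_Tensor[OF coalg unit_is_coalgebra coalg coalg coalgebra_mor_Ident[OF coalg]
       eta_coalgebra_mor])
  have w: "coalgebra_mor C A A ?w"
    using coalgebra_mor_Comp[OF AK coalg_HH coalg \<eta> M] by (simp add: AKmor)
  have "convolution C (unit_coalgebra C) mu eta eta = eta"
    by (simp add: convolution_def mu_eta_eta)
  then have "?w = conv A ?w (?G \<cdot> (\<I> H \<otimes> eta))"
    using distributes_conv[OF unit_is_coalgebra _ _ MH MH GH dist, of eta eta] by (simp add: AKconv Hom_iff)
  also have "?G \<cdot> (\<I> H \<otimes> eta) = conv A (lam \<cdot> \<sigma>) ?w"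
  proof -
    have "(lam \<cdot> (\<sigma> \<cdot> q)) \<cdot> (\<I> H \<otimes> eta) = lam \<cdot> \<sigma>"
      by (simp add: comp_assoc interchange counit_coprod_eta)
    then show ?thesis
      using convolution_Comp[OF AK coalg_HH alg _ _ \<eta>, of "lam \<cdot> (\<sigma> \<cdot> q)" M] lH MH by (simp add: AKconv)
  qed
  finally have idem: "conv A ?w (conv A (lam \<cdot> \<sigma>) ?w) = ?w" ..
  note wH = coalgebra_mor_Hom[OF w] and lsH = lam_Comp_Hom[OF \<sigma>H]
  note u = conv_in_Hom[OF coalg lsH wH]
  have "conv A (lam \<cdot> \<sigma>) ?w = conv A (conv A (lam \<cdot> ?w) ?w) (conv A (lam \<cdot> \<sigma>) ?w)"
    by (simp add: conv_antipode[OF coalg w] convolution_unit[OF coalg alg u])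
  also have "\<dots> = conv A (lam \<cdot> ?w) ?w"
    by (simp add: convolution_assoc[OF coalg alg lam_Comp_Hom[OF wH] wH u] idem)
  also have "\<dots> = eta \<cdot> eps"
    by (rule conv_antipode[OF coalg w])
  finally show ?thesis
    using convolution_inverse_unique[OF coalg alg \<sigma>H lsH wH] conv_antipode[OF coalg \<sigma>] by simp
qed

text \<open>The delicate axiom is the compatibility of \<open>\<Gamma>\<close> with the second product. Expanding both sides, it reduces to
\<open>V * (lam \<cdot> s) = lam \<cdot> W\<close> in the notation of the proof; here \<open>W * V\<close> equals \<open>s\<close> by the distributive law, so
that the left-hand side is a convolution inverse of \<open>W\<close>. Only the fact that \<open>\<Gamma>\<close> is a coalgebra
morphism depends on the star condition.\<close>

lemma post_hopf_of_truss:
  assumes tr: "truss M \<sigma>" and star: "star_condition C A (gam \<sigma> M)"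
  shows "post_hopf (gam \<sigma> M) \<sigma>"
proof -
  let ?G = "gam \<sigma> M" and ?l = "lam \<cdot> (\<sigma> \<cdot> q)"
  have M: "coalgebra_mor C HH A M" and \<sigma>: "coalgebra_mor C A A \<sigma>"
    and assoc: "M \<cdot> (M \<otimes> \<I> H) = M \<cdot> (\<I> H \<otimes> M)"
    and dist: "distributes M M ?G"
    using tr by (auto simp: truss_def)
  have \<sigma>q: "coalgebra_mor C HH A (\<sigma> \<cdot> q)"
    by (rule coalgebra_mor_Comp[OF coalg_HH coalg coalg q_coalgebra_mor \<sigma>])
  note MH = coalgebra_mor_Hom[OF M, simplified] and \<sigma>H = coalgebra_mor_Hom[OF \<sigma>]
    and \<sigma>qH = coalgebra_mor_Hom[OF \<sigma>q, simplified]
  note lH = lam_Comp_Hom[OF \<sigma>qH]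
  note GH = conv_in_Hom[OF coalg_HH, simplified, OF lH MH]
  note [simp] = MH[unfolded Hom_iff] \<sigma>H[unfolded Hom_iff] GH[unfolded Hom_iff]
  have epsM: "eps \<cdot> M = eps \<otimes> eps" using M by (simp add: coalgebra_mor_def)
  have G: "coalgebra_mor C HH A ?G"
    by (rule coalgebra_mor_antipode_conv[OF coalg_HH \<sigma>q M star_condition_commute[OF GH \<sigma>H star]])
  \<comment> \<open>Associativity of \<open>M\<close> with the unit of \<open>H\<close> in the last variable.\<close>
  have \<sigma>M: "\<sigma> \<cdot> M = M \<cdot> (\<I> H \<otimes> \<sigma>)"
  proof -
    have "\<sigma> \<cdot> M = M \<cdot> ((\<I> H \<otimes> eta) \<cdot> M)"
      by (simp add: comp_assoc flip: truss_cocycle[OF tr])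
    also have "(\<I> H \<otimes> eta) \<cdot> M = (M \<otimes> \<I> H) \<cdot> (\<I> H \<otimes> \<I> H \<otimes> eta)"
      using interchange[of M "\<I> H" "\<I> \<K>" eta] interchange[of "\<I> (H \<otimes>\<^sub>o H)" M eta "\<I> H"]
      by (simp add: Ident_Tensor Tensor_assoc)
    also have "M \<cdot> \<dots> = (M \<cdot> (M \<otimes> \<I> H)) \<cdot> (\<I> H \<otimes> \<I> H \<otimes> eta)"
      by (simp add: comp_assoc)
    also have "\<dots> = M \<cdot> (\<I> H \<otimes> (M \<cdot> (\<I> H \<otimes> eta)))"
      unfolding assoc by (simp add: comp_assoc interchange)
    finally show ?thesis by (simp add: truss_cocycle[OF tr])
  qed
  have distG: "distributes ?G ?G ?G"
    using distributes_circ[OF lam_Comp_Hom[OF \<sigma>H] MH GH dist] by (simp add: comp_assoc)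
  have "?G \<cdot> (\<I> H \<otimes> ?G) = ?G \<cdot> (M \<otimes> \<I> H)"
  proof -
    let ?s = "\<sigma> \<cdot> (\<I> H \<otimes> eps \<otimes> eps)" and ?W = "M \<cdot> (\<I> H \<otimes> (\<sigma> \<cdot> q))" and ?V = "?G \<cdot> (\<I> H \<otimes> ?l)"
    have s: "coalgebra_mor C HHH A ?s"
      using coalgebra_mor_Comp[OF coalg_HHH coalg_HH coalg whisker_coalgebra_mor(1)[OF M] \<sigma>q]
      by (simp add: comp_assoc q_Comp(1)[OF MH epsM])
    have W: "coalgebra_mor C HHH A ?W"
      by (rule coalgebra_mor_Comp[OF coalg_HHH coalg_HH coalg whisker_coalgebra_mor(1)[OF \<sigma>q] M])
    note sH = coalgebra_mor_Hom[OF s] and WH = coalgebra_mor_Hom[OF W]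
    have VH: "?V \<in> Hom (carr HHH) H" using lH by (simp add: Hom_iff)
    have ls: "?l \<cdot> (\<I> H \<otimes> M) = lam \<cdot> ?s"
      by (simp add: comp_assoc q_Comp(1)[OF MH epsM])
    have lW: "?l \<cdot> (M \<otimes> \<I> H) = lam \<cdot> ?W"
    proof -
      have "\<sigma> \<cdot> (q \<cdot> (M \<otimes> \<I> H)) = (\<sigma> \<cdot> M) \<cdot> (\<I> H \<otimes> q)"
        by (simp add: comp_assoc q_Comp(2)[OF MH])
      also have "\<dots> = ?W"
        unfolding \<sigma>M by (simp add: comp_assoc interchange)
      finally show ?thesis by (simp add: comp_assoc)
    qed
    have "conv HHH ?W ?V = M \<cdot> (\<I> H \<otimes> conv HH (\<sigma> \<cdot> q) ?l)"
      using distributes_conv[OF coalg_HH _ _ MH MH GH dist] \<sigma>qH lH by simp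
    also have "\<dots> = (M \<cdot> (\<I> H \<otimes> eta)) \<cdot> (\<I> H \<otimes> eps \<otimes> eps)"
      by (simp add: conv_antipode[OF coalg_HH \<sigma>q] comp_assoc interchange)
    also have "\<dots> = ?s"
      by (simp add: truss_cocycle[OF tr])
    finally have "conv HHH ?W (conv HHH ?V (lam \<cdot> ?s)) = eta \<cdot> counit HHH"
      using convolution_assoc[OF coalg_HHH alg WH VH lam_Comp_Hom[OF sH]]
      by (simp add: conv_antipode[OF coalg_HHH s])
    then have V: "lam \<cdot> ?W = conv HHH ?V (lam \<cdot> ?s)"
      by (intro convolution_inverse_unique[OF coalg_HHH alg lam_Comp_Hom[OF WH] WH
          conv_in_Hom[OF coalg_HHH VH lam_Comp_Hom[OF sH]] conv_antipode(1)[OF coalg_HHH W]])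
    have MMH: "M \<cdot> (\<I> H \<otimes> M) \<in> Hom (carr HHH) H" by (simp add: Hom_iff)
    have "?G \<cdot> (\<I> H \<otimes> ?G) = conv HHH ?V (conv HHH (lam \<cdot> ?s) (M \<cdot> (\<I> H \<otimes> M)))"
      using distributes_conv[OF coalg_HH _ _ GH GH GH distG, of ?l M] lH MH
      unfolding conv_whisker(1)[OF lH MH M] ls by simp
    also have "\<dots> = conv HHH (lam \<cdot> ?W) (M \<cdot> (\<I> H \<otimes> M))"
      unfolding V by (rule convolution_assoc[OF coalg_HHH alg VH lam_Comp_Hom[OF sH] MMH, symmetric])
    also have "\<dots> = ?G \<cdot> (M \<otimes> \<I> H)"
      unfolding conv_whisker(2)[OF lH MH M] lW assoc ..
    finally show ?thesis .
  qed
  with G \<sigma> \<sigma>M distG show ?thesis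
    by (simp add: post_hopf_def gam_circ[OF \<sigma> MH])
qed

section \<open>Comparison with the definitions\<close>

lemma wt_post_hopf_iff: "is_wt_post_hopf C (A, m, \<Phi>) \<longleftrightarrow> post_hopf m \<Phi>"
proof (cases "coalgebra_mor C HH A m \<and> coalgebra_mor C A A \<Phi>")
  case True
  then have m: "m \<in> Hom (H \<otimes>\<^sub>o H) H" and \<Phi>: "\<Phi> \<in> Hom H H"
    by (auto simp: coalgebra_mor_def)
  note [simp] = m[unfolded Hom_iff] \<Phi>[unfolded Hom_iff]
  have 1: "mu \<cdot> (\<Phi> \<otimes> m) \<cdot> (del \<otimes> \<I> H) = circ \<Phi> m"
    by (simp add: conv_q[OF \<Phi> m] comp_assoc)
  have 2: "\<Phi> \<cdot> mu \<cdot> (\<Phi> \<otimes> m) \<cdot> (del \<otimes> \<I> H) = \<Phi> \<cdot> circ \<Phi> m"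
    by (simp add: conv_q[OF \<Phi> m] comp_assoc)
  have 3: "mu \<cdot> (\<Phi> \<otimes> m) \<cdot> (del \<otimes> \<Phi>) = circ \<Phi> m \<cdot> (\<I> H \<otimes> \<Phi>)"
    by (simp add: conv_q[OF \<Phi> m] comp_assoc interchange)
  show ?thesis
    using True hopf by (simp add: is_wt_post_hopf_def post_hopf_def distributes_def Let_def 1 2 3)
qed (auto simp: is_wt_post_hopf_def post_hopf_def Let_def)

lemma truss_Gamma_eq:
  assumes "coalgebra_mor C A A \<sigma>" "mult A2 \<in> Hom (H \<otimes>\<^sub>o H) H"
  shows "truss_Gamma C A A2 \<sigma> = gam \<sigma> (mult A2)"
proof -
  note \<sigma> = coalgebra_mor_Hom[OF assms(1)]
  note [simp] = \<sigma>[unfolded Hom_iff] assms(2)[unfolded Hom_iff]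
  show ?thesis
    using conv_q[OF lam_Comp_Hom[OF \<sigma>] assms(2)] by (simp add: truss_Gamma_def comp_assoc)
qed

lemma hopf_truss_iff:
  "is_hopf_truss C (A, A2, \<sigma>) \<longleftrightarrow>
    carr A2 = carr A \<and> counit A2 = counit A \<and> coprod A2 = coprod A \<and> truss (mult A2) \<sigma>"
proof (cases "carr A2 = carr A \<and> counit A2 = counit A \<and> coprod A2 = coprod A \<and>
    coalgebra_mor C A A \<sigma> \<and> coalgebra_mor C HH A (mult A2)")
  case True
  have "tensor_coalgebra C A2 A2 = HH" using True by (simp add: tensor_coalgebra_def)
  moreover have "coalgebra_mor C HH A2 f = coalgebra_mor C HH A f" for f
    using True by (simp add: coalgebra_mor_def)
  moreover have "is_coalgebra C A2" using True coalg by (simp add: is_coalgebra_def)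
  moreover have "truss_Gamma C A A2 \<sigma> = gam \<sigma> (mult A2)"
    using True by (intro truss_Gamma_eq) (simp_all add: coalgebra_mor_def)
  ultimately show ?thesis
    using True hopf
    by (simp add: is_hopf_truss_def truss_def is_nonunital_bialgebra_def distributes_def Let_def)
next
  case False
  then show ?thesis
    by (auto simp: is_hopf_truss_def truss_def is_nonunital_bialgebra_def Let_def coalgebra_mor_def
        tensor_coalgebra_def)
qed

end

section \<open>Morphisms\<close>

locale hopf_algebra_morphism =
  A: hopf_algebra_in_category C A + B: hopf_algebra_in_category C B
  for C :: "('o, 'a, 'z) braided_category_scheme" (structure)
    and A B :: "('o, 'a) hopf_algebra" +
  fixes f :: 'a
  assumes mor: "hopf_algebra_mor C A B f"
begin

lemma f_coalgebra_mor: "coalgebra_mor C A B f"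
  and f_eta: "f \<cdot> A.eta = B.eta" and f_mu: "f \<cdot> A.mu = B.mu \<cdot> (f \<otimes> f)"
  using mor by (simp_all add: hopf_algebra_mor_def)

lemma f_Hom: "f \<in> Hom A.H B.H" and f_typing [simp]: "f \<in> Arr C" "Dom C f = A.H" "Cod C f = B.H"
  using f_coalgebra_mor by (simp_all add: coalgebra_mor_def Hom_iff)

text \<open>A Hopf algebra morphism preserves the antipodes, by uniqueness of convolution inverses.\<close>

lemma f_antipode: "B.lam \<cdot> f = f \<cdot> A.lam"
proof (rule A.convolution_inverse_unique[OF A.coalg B.alg])
  show "convolution C A B.mu (B.lam \<cdot> f) f = B.eta \<cdot> A.eps"
    by (rule B.conv_antipode[OF A.coalg f_coalgebra_mor])
  have "f \<cdot> convolution C A A.mu (\<I> A.H) A.lam = convolution C A B.mu f (f \<cdot> A.lam)"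
    by (subst A.Comp_convolution[OF A.coalg A.alg B.alg _ _ f_Hom f_mu]) (simp_all add: Hom_iff)
  then show "convolution C A B.mu f (f \<cdot> A.lam) = B.eta \<cdot> A.eps"
    by (simp add: A.lam_inverse A.comp_left[OF f_eta])
qed (simp_all add: Hom_iff)

lemma f_circ:
  assumes s: "s \<in> Hom A.H A.H" and s': "s' \<in> Hom B.H B.H" and t: "t \<in> Hom (A.H \<otimes>\<^sub>o A.H) A.H"
    and t': "t' \<in> Hom (B.H \<otimes>\<^sub>o B.H) B.H"
    and fs: "s' \<cdot> f = f \<cdot> s" and ft: "f \<cdot> t = t' \<cdot> (f \<otimes> f)"
  shows "f \<cdot> A.circ s t = B.circ s' t' \<cdot> (f \<otimes> f)"
proof -
  note [simp] = s[unfolded Hom_iff] s'[unfolded Hom_iff] t[unfolded Hom_iff] t'[unfolded Hom_iff]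
  have "B.q \<cdot> (f \<otimes> f) = f \<otimes> A.eps"
    using f_coalgebra_mor by (simp add: A.interchange coalgebra_mor_def)
  also have "\<dots> = f \<cdot> A.q"
    using A.interchange[of "\<I> A.H" f "A.eps" "\<I> \<K>"] by simp
  finally have q: "(s' \<cdot> B.q) \<cdot> (f \<otimes> f) = f \<cdot> (s \<cdot> A.q)"
    by (simp add: A.comp_assoc A.comp_left[OF fs])
  have "B.circ s' t' \<cdot> (f \<otimes> f) =
      convolution C A.HH B.mu ((s' \<cdot> B.q) \<cdot> (f \<otimes> f)) (t' \<cdot> (f \<otimes> f))"
    by (rule A.convolution_Comp[OF A.coalg_HH B.coalg_HH B.alg _ _
        A.coalgebra_mor_Tensor[OF A.coalg A.coalg B.coalg B.coalg f_coalgebra_mor f_coalgebra_mor]])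
      (simp_all add: Hom_iff)
  also have "\<dots> = f \<cdot> A.circ s t"
    unfolding q ft[symmetric]
    by (rule A.Comp_convolution[OF A.coalg_HH A.alg B.alg _ _ f_Hom f_mu, symmetric])
      (simp_all add: Hom_iff)
  finally show ?thesis by simp
qed

text \<open>Morphisms of trusses are not required to preserve the cocycle; they do so because the cocycle is
determined by the second product.\<close>

lemma f_truss:
  assumes A: "A.truss M \<sigma>" and B: "B.truss N \<tau>" and fM: "f \<cdot> M = N \<cdot> (f \<otimes> f)"
  shows "\<tau> \<cdot> f = f \<cdot> \<sigma>" "f \<cdot> A.gam \<sigma> M = B.gam \<tau> N \<cdot> (f \<otimes> f)"
proof -
  have h: "M \<in> Hom (A.H \<otimes>\<^sub>o A.H) A.H" "N \<in> Hom (B.H \<otimes>\<^sub>o B.H) B.H" "\<sigma> \<in> Hom A.H A.H" "\<tau> \<in> Hom B.H B.H"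
    using A B by (simp_all add: A.truss_def B.truss_def coalgebra_mor_def)
  note [simp] = h[unfolded Hom_iff]
  have "f \<otimes> B.eta = (\<I> B.H \<otimes> B.eta) \<cdot> f"
    using A.interchange[of f "\<I> B.H" "\<I> \<K>" "B.eta"] by simp
  then have "f \<cdot> (M \<cdot> (\<I> A.H \<otimes> A.eta)) = (N \<cdot> (\<I> B.H \<otimes> B.eta)) \<cdot> f"
    by (simp add: A.comp_left[OF fM] A.comp_assoc A.interchange f_eta)
  then show \<sigma>: "\<tau> \<cdot> f = f \<cdot> \<sigma>"
    by (simp add: A.truss_cocycle[OF A] B.truss_cocycle[OF B])
  have "(B.lam \<cdot> \<tau>) \<cdot> f = f \<cdot> (A.lam \<cdot> \<sigma>)"
    by (simp add: A.comp_assoc \<sigma> A.comp_left[OF f_antipode])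
  from f_circ[OF _ _ h(1,2) this fM] show "f \<cdot> A.gam \<sigma> M = B.gam \<tau> N \<cdot> (f \<otimes> f)"
    by (simp add: A.comp_assoc Hom_iff)
qed

end

section \<open>The isomorphism of categories\<close>

text \<open>The coalgebra of \<open>A\<close> with the second product of the truss associated with \<open>(A, m, \<Phi>)\<close>.\<close>

definition post_hopf_product ::
    "('o, 'a, 'z) braided_category_scheme \<Rightarrow> ('o, 'a) hopf_algebra \<Rightarrow> 'a \<Rightarrow> 'a \<Rightarrow> ('o, 'a) nonunital_bialgebra" where
  "post_hopf_product C A m \<Phi> = \<lparr>carr = carr A, counit = counit A, coprod = coprod A,
    mult = convolution C (tensor_coalgebra C A A) (mult A)
      (\<Phi> \<cdot>\<^bsub>C\<^esub> (\<I>\<^bsub>C\<^esub> (carr A) \<otimes>\<^bsub>C\<^esub> counit A)) m\<rparr>"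

lemma post_hopf_product_sel [simp]:
  "carr (post_hopf_product C A m \<Phi>) = carr A" "counit (post_hopf_product C A m \<Phi>) = counit A"
  "coprod (post_hopf_product C A m \<Phi>) = coprod A"
  "mult (post_hopf_product C A m \<Phi>) = convolution C (tensor_coalgebra C A A) (mult A)
      (\<Phi> \<cdot>\<^bsub>C\<^esub> (\<I>\<^bsub>C\<^esub> (carr A) \<otimes>\<^bsub>C\<^esub> counit A)) m"
  by (simp_all add: post_hopf_product_def)

text \<open>The object part of the functor to Hopf trusses.\<close>

fun truss_of_post :: "('o, 'a, 'z) braided_category_scheme \<Rightarrow> ('o, 'a) wt_post_hopf \<Rightarrow> ('o, 'a) hopf_truss" where
  "truss_of_post C (A, m, \<Phi>) = (A, post_hopf_product C A m \<Phi>, \<Phi>)"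

text \<open>The object part of the inverse functor.\<close>

fun post_of_truss :: "('o, 'a, 'z) braided_category_scheme \<Rightarrow> ('o, 'a) hopf_truss \<Rightarrow> ('o, 'a) wt_post_hopf" where
  "post_of_truss C (A, A2, \<sigma>) = (A, truss_Gamma C A A2 \<sigma>, \<sigma>)"

text \<open>The objects of the two categories in question.\<close>

definition star_post_hopfs :: "('o, 'a, 'z) braided_category_scheme \<Rightarrow> ('o, 'a) wt_post_hopf set" where
  "star_post_hopfs C = {(A, m, \<Phi>). is_wt_post_hopf C (A, m, \<Phi>) \<and> star_condition C A m}"

definition star_trusses :: "('o, 'a, 'z) braided_category_scheme \<Rightarrow> ('o, 'a) hopf_truss set" where
  "star_trusses C = {(A, A2, \<sigma>). is_hopf_truss C (A, A2, \<sigma>) \<and> star_condition C A (truss_Gamma C A A2 \<sigma>)}"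

lemma full_structure_category:
  "full_subcategory (structure_category C S U mor) P = structure_category C {X \<in> S. P X} U mor"
  by (auto simp: full_subcategory_def structure_category_def)

lemma wt_Post_Hopf_star_eq:
  "wt_Post_Hopf_star C =
    structure_category C (star_post_hopfs C) (\<lambda>(A, m, \<Phi>). carr A) (wt_post_hopf_mor C)"
  by (auto simp: wt_Post_Hopf_star_def wt_Post_Hopf_def full_structure_category star_post_hopfs_def
      intro: arg_cong[where f = "\<lambda>S. structure_category C S _ _"])

lemma HTr_star_eq:
  "HTr_star C = structure_category C (star_trusses C) (\<lambda>(A, A2, \<sigma>). carr A) (hopf_truss_mor C)"
  by (auto simp: HTr_star_def HTr_def full_structure_category star_trusses_def
      intro: arg_cong[where f = "\<lambda>S. structure_category C S _ _"])

context strict_braided_monoidal_category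
begin

lemma structure_category:
  assumes "\<And>A. A \<in> S \<Longrightarrow> U A \<in> Obj C"
    and "\<And>A B f. \<lbrakk>A \<in> S; B \<in> S; mor A B f\<rbrakk> \<Longrightarrow> f \<in> Hom (U A) (U B)"
    and "\<And>A. A \<in> S \<Longrightarrow> mor A A (\<I> (U A))"
    and "\<And>A B D f g. \<lbrakk>A \<in> S; B \<in> S; D \<in> S; mor A B f; mor B D g\<rbrakk> \<Longrightarrow> mor A D (g \<cdot> f)"
  shows "category (structure_category C S U mor)"
  using assms(1,3,4) Comp_Ident_left[OF assms(2)] Comp_Ident_right[OF assms(2)]
    Comp_assoc[OF assms(2) assms(2) assms(2)]
  by unfold_locales (auto simp: structure_category_def Hom_def)

text \<open>A bijection of objects that respects the underlying objects and identifies the morphisms gives an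
isomorphism of categories that leaves the underlying arrows unchanged. That the second system of
morphisms is closed under composition follows from the first.\<close>

lemma structure_categories_isomorphic:
  assumes obj: "\<And>A. A \<in> S \<Longrightarrow> U A \<in> Obj C"
    and hom: "\<And>A B f. \<lbrakk>A \<in> S; B \<in> S; mor A B f\<rbrakk> \<Longrightarrow> f \<in> Hom (U A) (U B)"
    and ident: "\<And>A. A \<in> S \<Longrightarrow> mor A A (\<I> (U A))"
    and comp: "\<And>A B D f g. \<lbrakk>A \<in> S; B \<in> S; D \<in> S; mor A B f; mor B D g\<rbrakk> \<Longrightarrow> mor A D (g \<cdot> f)"
    and F: "\<And>A. A \<in> S \<Longrightarrow> F A \<in> S' \<and> U' (F A) = U A \<and> G (F A) = A"
    and G: "\<And>B. B \<in> S' \<Longrightarrow> G B \<in> S \<and> F (G B) = B"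
    and mor: "\<And>A B f. \<lbrakk>A \<in> S; B \<in> S\<rbrakk> \<Longrightarrow> mor' (F A) (F B) f \<longleftrightarrow> mor A B f"
  shows "isomorphic_categories (structure_category C S U mor) (structure_category C S' U' mor')"
proof -
  let ?X = "structure_category C S U mor" and ?Y = "structure_category C S' U' mor'"
  have G': "G B \<in> S" "F (G B) = B" "U (G B) = U' B" if "B \<in> S'" for B
    using G[OF that] F[of "G B"] by auto
  have mor': "mor' A B f \<longleftrightarrow> mor (G A) (G B) f" if "A \<in> S'" "B \<in> S'" for A B f
    using mor[of "G A" "G B" f] G'[OF that(1)] G'[OF that(2)] by simp
  have X: "category ?X" by (rule structure_category) (fact obj hom ident comp)+
  have Y: "category ?Y"
  proof (rule structure_category)
    show "U' A \<in> Obj C" if "A \<in> S'" for A using obj[of "G A"] G'[OF that] by simp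
    show "f \<in> Hom (U' A) (U' B)" if "A \<in> S'" "B \<in> S'" "mor' A B f" for A B f
      using hom[of "G A" "G B" f] that G' by (simp add: mor')
    show "mor' A A (\<I> (U' A))" if "A \<in> S'" for A
      using ident[of "G A"] that G' by (simp add: mor')
    show "mor' A D (g \<cdot> f)" if "A \<in> S'" "B \<in> S'" "D \<in> S'" "mor' A B f" "mor' B D g" for A B D f g
      using comp[of "G A" "G B" "G D" f g] that G' by (simp add: mor')
  qed
  have 1: "covariant_functor ?X ?Y F (\<lambda>(A, f, B). (F A, f, F B))"
    unfolding covariant_functor_def covariant_functor_axioms_def
    using X Y F by (auto simp: structure_category_def Hom_def mor)
  have 2: "covariant_functor ?Y ?X G (\<lambda>(A, f, B). (G A, f, G B))"
    unfolding covariant_functor_def covariant_functor_axioms_def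
    using X Y G' by (auto simp: structure_category_def Hom_def mor')
  have 3: "\<forall>X \<in> Obj ?X. G (F X) = X" "\<forall>f \<in> Arr ?X. (\<lambda>(A, f, B). (G A, f, G B)) ((\<lambda>(A, f, B). (F A, f, F B)) f) = f"
    "\<forall>X \<in> Obj ?Y. F (G X) = X" "\<forall>f \<in> Arr ?Y. (\<lambda>(A, f, B). (F A, f, F B)) ((\<lambda>(A, f, B). (G A, f, G B)) f) = f"
    using F G by (auto simp: structure_category_def)
  show ?thesis
    unfolding isomorphic_categories_def using 1 2 3 by blast
qed

lemma truss_of_post_star:
  assumes "X \<in> star_post_hopfs C"
  shows "truss_of_post C X \<in> star_trusses C \<and> post_of_truss C (truss_of_post C X) = X"
proof -
  obtain A m \<Phi> where X: "X = (A, m, \<Phi>)" by (cases X)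
  then have p: "is_wt_post_hopf C (A, m, \<Phi>)" and star: "star_condition C A m"
    using assms by (auto simp: star_post_hopfs_def)
  then interpret hopf_algebra_in_category C A
    by unfold_locales (simp add: is_wt_post_hopf_def Let_def)
  have p': "post_hopf m \<Phi>" using p by (simp add: wt_post_hopf_iff)
  have tr: "truss (circ \<Phi> m) \<Phi>" by (rule truss_of_post_hopf[OF p' star])
  have "truss_Gamma C A (post_hopf_product C A m \<Phi>) \<Phi> = gam \<Phi> (circ \<Phi> m)"
    using tr by (subst truss_Gamma_eq) (auto simp: truss_def coalgebra_mor_def)
  also have "\<dots> = m"
    using p' by (intro gam_circ(1)) (auto simp: post_hopf_def coalgebra_mor_def)
  finally show ?thesis
    using tr star by (simp add: X star_trusses_def hopf_truss_iff)
qed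

lemma post_of_truss_star:
  assumes "X \<in> star_trusses C"
  shows "post_of_truss C X \<in> star_post_hopfs C \<and> truss_of_post C (post_of_truss C X) = X"
proof -
  obtain A A2 \<sigma> where X: "X = (A, A2, \<sigma>)" by (cases X)
  then have p: "is_hopf_truss C (A, A2, \<sigma>)" and star: "star_condition C A (truss_Gamma C A A2 \<sigma>)"
    using assms by (auto simp: star_trusses_def)
  then interpret hopf_algebra_in_category C A
    by unfold_locales (simp add: is_hopf_truss_def Let_def)
  have A2: "carr A2 = carr A" "counit A2 = counit A" "coprod A2 = coprod A" and tr: "truss (mult A2) \<sigma>"
    using p by (simp_all add: hopf_truss_iff)
  then have \<sigma>: "coalgebra_mor C A A \<sigma>" and M: "mult A2 \<in> Hom (H \<otimes>\<^sub>o H) H"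
    by (auto simp: truss_def coalgebra_mor_def)
  have \<Gamma>: "truss_Gamma C A A2 \<sigma> = gam \<sigma> (mult A2)" by (rule truss_Gamma_eq[OF \<sigma> M])
  have "post_hopf_product C A (gam \<sigma> (mult A2)) \<sigma> = A2"
    using A2 by (intro nonunital_bialgebra.equality) (simp_all add: gam_circ(2)[OF \<sigma> M])
  then show ?thesis
    using post_hopf_of_truss[OF tr] star by (simp add: X \<Gamma> star_post_hopfs_def wt_post_hopf_iff)
qed

text \<open>Both functors leave underlying arrows unchanged, so they act on morphisms by this equivalence.\<close>

lemma hopf_truss_mor_iff:
  assumes "X \<in> star_post_hopfs C" "Y \<in> star_post_hopfs C"
  shows "hopf_truss_mor C (truss_of_post C X) (truss_of_post C Y) f \<longleftrightarrow> wt_post_hopf_mor C X Y f"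
proof -
  obtain A m \<Phi> where X: "X = (A, m, \<Phi>)" by (cases X)
  obtain B n \<Psi> where Y: "Y = (B, n, \<Psi>)" by (cases Y)
  have p: "is_wt_post_hopf C (A, m, \<Phi>)" "is_wt_post_hopf C (B, n, \<Psi>)"
    and star: "star_condition C A m" "star_condition C B n"
    using assms by (auto simp: star_post_hopfs_def X Y)
  show ?thesis
  proof (cases "hopf_algebra_mor C A B f")
    case True
    interpret hopf_algebra_morphism C A B f
      using p True by unfold_locales (simp_all add: is_wt_post_hopf_def Let_def)
    have A: "A.post_hopf m \<Phi>" and B: "B.post_hopf n \<Psi>"
      using p by (simp_all add: A.wt_post_hopf_iff B.wt_post_hopf_iff)
    have m: "m \<in> Hom (A.H \<otimes>\<^sub>o A.H) A.H" and n: "n \<in> Hom (B.H \<otimes>\<^sub>o B.H) B.H"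
      and \<Phi>: "coalgebra_mor C A A \<Phi>" and \<Psi>: "coalgebra_mor C B B \<Psi>"
      using A B by (auto simp: A.post_hopf_def B.post_hopf_def coalgebra_mor_def)
    have "f \<cdot> A.circ \<Phi> m = B.circ \<Psi> n \<cdot> (f \<otimes> f) \<longleftrightarrow> f \<cdot> m = n \<cdot> (f \<otimes> f) \<and> \<Psi> \<cdot> f = f \<cdot> \<Phi>"
      using f_truss[OF A.truss_of_post_hopf[OF A star(1)] B.truss_of_post_hopf[OF B star(2)]]
        f_circ[OF coalgebra_mor_Hom[OF \<Phi>] coalgebra_mor_Hom[OF \<Psi>] m n]
      by (auto simp: A.gam_circ[OF \<Phi> m] B.gam_circ[OF \<Psi> n])
    then show ?thesis
      using mor f_coalgebra_mor
      by (simp add: X Y hopf_truss_mor_def wt_post_hopf_mor_def nonunital_bialgebra_mor_def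
          coalgebra_mor_def)
  qed (simp add: X Y hopf_truss_mor_def wt_post_hopf_mor_def)
qed

lemma hopf_algebra_mor_Comp:
  assumes A: "is_hopf_algebra C A" and B: "is_hopf_algebra C B" and D: "is_hopf_algebra C D"
    and f: "hopf_algebra_mor C A B f" and g: "hopf_algebra_mor C B D g"
  shows "hopf_algebra_mor C A D (g \<cdot> f)"
proof -
  interpret f: hopf_algebra_morphism C A B f
    using A B f by unfold_locales
  interpret g: hopf_algebra_morphism C B D g
    using B D g by unfold_locales
  have "coalgebra_mor C A D (g \<cdot> f)"
    by (rule coalgebra_mor_Comp[OF f.A.coalg f.B.coalg g.B.coalg f.f_coalgebra_mor g.f_coalgebra_mor])
  then show ?thesis
    by (simp add: hopf_algebra_mor_def comp_assoc f.f_eta g.f_eta f.f_mu comp_left[OF g.f_mu] interchange)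
qed

lemma wt_post_hopf_mor_Comp:
  assumes "is_wt_post_hopf C X" "is_wt_post_hopf C Y" "is_wt_post_hopf C Z"
    and "wt_post_hopf_mor C X Y f" "wt_post_hopf_mor C Y Z g"
  shows "wt_post_hopf_mor C X Z (g \<cdot> f)"
proof -
  obtain A m \<Phi> B n \<Psi> D k \<Xi> where [simp]: "X = (A, m, \<Phi>)" "Y = (B, n, \<Psi>)" "Z = (D, k, \<Xi>)"
    by (cases X, cases Y, cases Z)
  have hopf: "is_hopf_algebra C A" "is_hopf_algebra C B" "is_hopf_algebra C D"
    and mor: "hopf_algebra_mor C A B f" "hopf_algebra_mor C B D g"
    and homs: "m \<in> Hom (carr A \<otimes>\<^sub>o carr A) (carr A)" "n \<in> Hom (carr B \<otimes>\<^sub>o carr B) (carr B)"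
      "k \<in> Hom (carr D \<otimes>\<^sub>o carr D) (carr D)" "\<Phi> \<in> Hom (carr A) (carr A)"
      "\<Psi> \<in> Hom (carr B) (carr B)" "\<Xi> \<in> Hom (carr D) (carr D)"
      "f \<in> Hom (carr A) (carr B)" "g \<in> Hom (carr B) (carr D)"
    and f: "f \<cdot> m = n \<cdot> (f \<otimes> f)" "\<Psi> \<cdot> f = f \<cdot> \<Phi>"
    and g: "g \<cdot> n = k \<cdot> (g \<otimes> g)" "\<Xi> \<cdot> g = g \<cdot> \<Psi>"
    using assms by (simp_all add: is_wt_post_hopf_def wt_post_hopf_mor_def hopf_algebra_mor_def
        coalgebra_mor_def Let_def)
  have [simp]: "carr A \<in> Obj C" "carr B \<in> Obj C" "carr D \<in> Obj C"
    using hopf by (simp_all add: is_hopf_algebra_def is_nonunital_bialgebra_def is_coalgebra_def)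
  note [simp] = homs[unfolded Hom_iff]
  show ?thesis
    using hopf_algebra_mor_Comp[OF hopf mor]
    by (simp add: wt_post_hopf_mor_def comp_assoc interchange f comp_left[OF g(1)] comp_left[OF g(2)])
qed

lemma wt_post_hopf_mor_Ident:
  assumes "is_wt_post_hopf C (A, m, \<Phi>)"
  shows "wt_post_hopf_mor C (A, m, \<Phi>) (A, m, \<Phi>) (\<I> (carr A))"
proof -
  interpret hopf_algebra_in_category C A
    using assms by unfold_locales (simp add: is_wt_post_hopf_def Let_def)
  show ?thesis
    using assms coalgebra_mor_Ident[OF coalg]
    by (simp add: wt_post_hopf_mor_def hopf_algebra_mor_def is_wt_post_hopf_def Let_def
        coalgebra_mor_def Hom_iff)
qed

theorem star_categories_isomorphic: "isomorphic_categories (wt_Post_Hopf_star C) (HTr_star C)"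
  unfolding wt_Post_Hopf_star_eq HTr_star_eq
proof (rule structure_categories_isomorphic[where F = "truss_of_post C" and G = "post_of_truss C"])
  fix X Y Z f g
  assume X: "X \<in> star_post_hopfs C"
  obtain A m \<Phi> where X': "X = (A, m, \<Phi>)" "is_wt_post_hopf C (A, m, \<Phi>)"
    using X by (auto simp: star_post_hopfs_def)
  then show "(case X of (A, m, \<Phi>) \<Rightarrow> carr A) \<in> Obj C"
    by (simp add: is_wt_post_hopf_def is_hopf_algebra_def is_nonunital_bialgebra_def is_coalgebra_def Let_def)
  show "wt_post_hopf_mor C X X (\<I> (case X of (A, m, \<Phi>) \<Rightarrow> carr A))"
    using wt_post_hopf_mor_Ident X' by simp
  show "truss_of_post C X \<in> star_trusses C \<and>
      (case truss_of_post C X of (A, A2, \<sigma>) \<Rightarrow> carr A) = (case X of (A, m, \<Phi>) \<Rightarrow> carr A) \<and>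
      post_of_truss C (truss_of_post C X) = X"
    using truss_of_post_star[OF X] by (simp add: X')
  assume Y: "Y \<in> star_post_hopfs C"
  show "hopf_truss_mor C (truss_of_post C X) (truss_of_post C Y) f = wt_post_hopf_mor C X Y f"
    by (rule hopf_truss_mor_iff[OF X Y])
  assume f: "wt_post_hopf_mor C X Y f"
  then show "f \<in> Hom (case X of (A, m, \<Phi>) \<Rightarrow> carr A) (case Y of (A, m, \<Phi>) \<Rightarrow> carr A)"
    by (cases X; cases Y) (simp add: wt_post_hopf_mor_def hopf_algebra_mor_def coalgebra_mor_def)
  assume "Z \<in> star_post_hopfs C" "wt_post_hopf_mor C Y Z g"
  then show "wt_post_hopf_mor C X Z (g \<cdot> f)"
    using wt_post_hopf_mor_Comp[of X Y Z f g] X Y f by (auto simp: star_post_hopfs_def)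
qed (rule post_of_truss_star)

end

theorem theorem3p11:
  fixes C :: "('o, 'a) braided_category"
  assumes "strict_braided_monoidal_category C"
  shows "isomorphic_categories (wt_Post_Hopf_star C) (HTr_star C)"
  using assms by (rule strict_braided_monoidal_category.star_categories_isomorphic)

end
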